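(* Let $G$ be a hypercentral group containing a finite contranormal subgroup. Then: (i) $G=VC$, where $V$ is a normal divisible abelian subgroup of $G$ and $C$ is a finite contranormal subgroup of $G$; (ii) $\Pi(G)=\Pi(C)$; in particular $\Pi(G)$ is finite; (iii) $V$ has a family $\{D_\mu \mid \mu\in M\}$ of $G$-invariant $G$-quasifinite subgroups such that $V=\langle D_\mu \mid \mu\in M\rangle$; (iv) $[D_\mu, C]=D_\mu$ for all $\mu\in M$; in particular $[V,C]=V$.
   Context: A subgroup $H$ of $G$ is contranormal in $G$ if its normal closure $H^G$ equals $G$. $\Pi(X)$ denotes the set of primes $p$ such that $X$ contains an element of order $p$. An infinite normal abelian subgroup $A$ of a group $G$ is called $G$-quasifinite if every proper $G$-invariant subgroup of $A$ is finite. *)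

theory Defs
  imports "HOL-Algebra.Algebra" "HOL-Computational_Algebra.Primes"
begin

definition comm_elt :: "('a, 'b) monoid_scheme \<Rightarrow> 'a \<Rightarrow> 'a \<Rightarrow> 'a" where
  "comm_elt G x y = inv\<^bsub>G\<^esub> x \<otimes>\<^bsub>G\<^esub> inv\<^bsub>G\<^esub> y \<otimes>\<^bsub>G\<^esub> x \<otimes>\<^bsub>G\<^esub> y"

definition comm_subgroup :: "('a, 'b) monoid_scheme \<Rightarrow> 'a set \<Rightarrow> 'a set \<Rightarrow> 'a set" where
  "comm_subgroup G A B = generate G {comm_elt G a b | a b. a \<in> A \<and> b \<in> B}"

(* upper hypercentre Z_infinity(G): least fixed point of the operator
   H |-> {x. [x,g] \<in> H \<union> {1} for all g}; its transfinite iteration from the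
   empty set is exactly the upper central series Z_1 \<le> Z_2 \<le> ... *)
inductive_set hypercentre :: "('a, 'b) monoid_scheme \<Rightarrow> 'a set" for G where
  "x \<in> carrier G \<Longrightarrow>
   (\<forall>g\<in>carrier G. comm_elt G x g = \<one>\<^bsub>G\<^esub> \<or> comm_elt G x g \<in> hypercentre G)
   \<Longrightarrow> x \<in> hypercentre G"

definition hypercentral :: "('a, 'b) monoid_scheme \<Rightarrow> bool" where
  "hypercentral G \<longleftrightarrow> group G \<and> hypercentre G = carrier G"

definition normal_closure :: "('a, 'b) monoid_scheme \<Rightarrow> 'a set \<Rightarrow> 'a set" where
  "normal_closure G H =
     generate G (\<Union>g\<in>carrier G. (\<lambda>h. g \<otimes>\<^bsub>G\<^esub> h \<otimes>\<^bsub>G\<^esub> inv\<^bsub>G\<^esub> g) ` H)"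

definition contranormal :: "('a, 'b) monoid_scheme \<Rightarrow> 'a set \<Rightarrow> bool" where
  "contranormal G H \<longleftrightarrow> subgroup H G \<and> normal_closure G H = carrier G"

definition prime_spectrum :: "('a, 'b) monoid_scheme \<Rightarrow> 'a set \<Rightarrow> nat set" where
  "prime_spectrum G S = {p. Factorial_Ring.prime p \<and> (\<exists>x\<in>S. group.ord G x = p)}"

definition abelian_subset :: "('a, 'b) monoid_scheme \<Rightarrow> 'a set \<Rightarrow> bool" where
  "abelian_subset G A \<longleftrightarrow> (\<forall>x\<in>A. \<forall>y\<in>A. x \<otimes>\<^bsub>G\<^esub> y = y \<otimes>\<^bsub>G\<^esub> x)"

definition divisible_subset :: "('a, 'b) monoid_scheme \<Rightarrow> 'a set \<Rightarrow> bool" where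
  "divisible_subset G A \<longleftrightarrow> (\<forall>x\<in>A. \<forall>n::nat. n > 0 \<longrightarrow> (\<exists>y\<in>A. y [^]\<^bsub>G\<^esub> n = x))"

(* G-invariant subgroup = normal subgroup of G *)
definition quasifinite :: "('a, 'b) monoid_scheme \<Rightarrow> 'a set \<Rightarrow> bool" where
  "quasifinite G A \<longleftrightarrow> infinite A \<and> A \<lhd> G \<and> abelian_subset G A \<and>
     (\<forall>B. B \<subset> A \<and> B \<lhd> G \<longrightarrow> finite B)"

end

theory Submission
  imports Defs
begin

text \<open>Let \<open>H\<close> be a finite contranormal subgroup and \<open>n = |H|\<close>. In a hypercentral group an element
  \<open>x\<close> of the second centre gives a homomorphism \<open>g \<mapsto> [x, g]\<close> into the centre; hence a hypercentral
  group generated by elements of \<open>n\<close>-power order consists of such elements, which applies to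
  \<open>G = H\<^sup>G\<close> and settles the prime spectrum with \<open>C = H\<close>.

  Maximal subgroups of hypercentral groups are normal, so \<open>NH = G\<close> for every normal \<open>N\<close> of finite
  index. Thus indices are bounded by \<open>n\<close> and there is a least normal subgroup \<open>V\<close> of finite index;
  \<open>V\<close> has no proper subgroup of finite index. A homomorphism from \<open>V\<close> with abelian image of finite
  exponent is trivial, so \<open>V\<close> is abelian (consider \<open>v \<mapsto> [x, v]\<close>) and divisible. As \<open>[V, H]H\<close>
  contains all conjugates of \<open>H\<close>, the subgroup \<open>[V, H]\<close> has finite index in \<open>V\<close>, so \<open>[V, H] = V\<close>.

  Finally \<open>V\<close> is a divisible torsion module for the finite group \<open>H\<close>. Maschke averaging gives every
  divisible invariant subgroup \<open>S\<close> a divisible invariant \<open>T\<close> with \<open>V = ST\<close> and \<open>S \<inter> T\<close> of exponent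
  \<open>n\<close>. Every nontrivial divisible invariant subgroup contains a divisible quasifinite one; taking
  \<open>S\<close> to be generated by all of these forces \<open>T = 1\<close>. If \<open>[D, H] \<noteq> D\<close> for one of them, then \<open>D\<close> is
  central, and \<open>S = D\<close> gives \<open>V = [V, H] \<le> T\<close>, which is absurd.\<close>

section \<open>Commutators, the centre and hypercentral groups\<close>

definition centre :: "('a, 'b) monoid_scheme \<Rightarrow> 'a set" where
  "centre G = {z \<in> carrier G. \<forall>g\<in>carrier G. z \<otimes>\<^bsub>G\<^esub> g = g \<otimes>\<^bsub>G\<^esub> z}"

text \<open>For \<open>n > 0\<close> this says that the order of \<open>x\<close> is finite with all
  its prime factors among those of \<open>n\<close>. Powers of one fixed \<open>n\<close> avoid a
  separate treatment of each prime.\<close>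

definition power_torsion :: "('a, 'b) monoid_scheme \<Rightarrow> nat \<Rightarrow> 'a \<Rightarrow> bool" where
  "power_torsion G n x \<longleftrightarrow> (\<exists>k::nat. x [^]\<^bsub>G\<^esub> (n ^ k) = \<one>\<^bsub>G\<^esub>)"

context group
begin

lemma l_inv_cancel: "\<lbrakk>x \<in> carrier G; y \<in> carrier G\<rbrakk> \<Longrightarrow> inv x \<otimes> (x \<otimes> y) = y"
  by (simp add: m_assoc[symmetric])

lemma r_inv_cancel: "\<lbrakk>x \<in> carrier G; y \<in> carrier G\<rbrakk> \<Longrightarrow> x \<otimes> (inv x \<otimes> y) = y"
  by (simp add: m_assoc[symmetric])

lemmas word_simps = m_assoc inv_mult_group l_inv_cancel r_inv_cancel

lemma conj_pow:
  assumes "x \<in> carrier G" "g \<in> carrier G"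
  shows "(g \<otimes> x \<otimes> inv g) [^] (m::nat) = g \<otimes> x [^] m \<otimes> inv g"
  by (induction m) (use assms in \<open>auto simp: word_simps\<close>)

lemma comm_elt_closed [intro, simp]:
  "\<lbrakk>x \<in> carrier G; y \<in> carrier G\<rbrakk> \<Longrightarrow> comm_elt G x y \<in> carrier G"
  by (simp add: comm_elt_def)

lemma comm_elt_eq_one_iff:
  assumes "x \<in> carrier G" "y \<in> carrier G"
  shows "comm_elt G x y = \<one> \<longleftrightarrow> x \<otimes> y = y \<otimes> x"
proof -
  have "(y \<otimes> x) \<otimes> comm_elt G x y = x \<otimes> y"
    using assms by (simp add: comm_elt_def word_simps)
  thus ?thesis
    using assms l_cancel[of "y \<otimes> x" "comm_elt G x y" \<one>] by auto
qed

lemma comm_elt_one [simp]: "x \<in> carrier G \<Longrightarrow> comm_elt G x \<one> = \<one>"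
  "x \<in> carrier G \<Longrightarrow> comm_elt G \<one> x = \<one>"
  by (simp_all add: comm_elt_eq_one_iff)

lemma comm_elt_mult_right:
  "\<lbrakk>x \<in> carrier G; g \<in> carrier G; h \<in> carrier G\<rbrakk> \<Longrightarrow>
   comm_elt G x (g \<otimes> h) = comm_elt G x h \<otimes> (inv h \<otimes> comm_elt G x g \<otimes> h)"
  by (simp add: comm_elt_def word_simps)

lemma comm_elt_mult_left:
  "\<lbrakk>x \<in> carrier G; y \<in> carrier G; g \<in> carrier G\<rbrakk> \<Longrightarrow>
   comm_elt G (x \<otimes> y) g = (inv y \<otimes> comm_elt G x g \<otimes> y) \<otimes> comm_elt G y g"
  by (simp add: comm_elt_def word_simps)

lemma comm_elt_conj:
  assumes "x \<in> carrier G" "y \<in> carrier G" "g \<in> carrier G"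
  shows "g \<otimes> comm_elt G x y \<otimes> inv g = comm_elt G (g \<otimes> x \<otimes> inv g) (g \<otimes> y \<otimes> inv g)"
  using assms by (simp add: comm_elt_def word_simps)

lemma comm_elt_mem_left:
  assumes "D \<lhd> G" "d \<in> D" "h \<in> carrier G"
  shows "comm_elt G d h \<in> D"
proof -
  interpret D: normal D G by fact
  have "comm_elt G d h = inv d \<otimes> (inv h \<otimes> d \<otimes> h)" using assms by (simp add: comm_elt_def word_simps)
  thus ?thesis using assms D.inv_op_closed1 by simp
qed

lemma centreD: "z \<in> centre G \<Longrightarrow> g \<in> carrier G \<Longrightarrow> z \<otimes> g = g \<otimes> z"
  unfolding centre_def by blast

lemma centre_closed [simp]: "z \<in> centre G \<Longrightarrow> z \<in> carrier G"
  by (simp add: centre_def)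

lemma centreI: "\<lbrakk>z \<in> carrier G; \<And>g. g \<in> carrier G \<Longrightarrow> z \<otimes> g = g \<otimes> z\<rbrakk> \<Longrightarrow> z \<in> centre G"
  unfolding centre_def by blast

lemma centre_conj:
  assumes "z \<in> centre G" "g \<in> carrier G"
  shows "inv g \<otimes> z \<otimes> g = z"
proof -
  have "inv g \<otimes> z \<otimes> g = inv g \<otimes> (z \<otimes> g)" using assms by (simp add: m_assoc)
  also have "\<dots> = inv g \<otimes> (g \<otimes> z)" by (simp only: centreD[OF assms])
  also have "\<dots> = z" using assms by (simp add: l_inv_cancel)
  finally show ?thesis .
qed

lemma centre_subgroup: "subgroup (centre G) G"
proof (rule subgroupI)
  have "\<one> \<in> centre G" by (rule centreI) auto
  thus "centre G \<noteq> {}" by blast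
  show "centre G \<subseteq> carrier G" by (rule subsetI) (rule centre_closed)
  show "inv a \<in> centre G" if a: "a \<in> centre G" for a
  proof (rule centreI)
    fix g assume g: "g \<in> carrier G"
    have "inv (a \<otimes> inv g) = inv (inv g \<otimes> a)" using centreD[OF a, of "inv g"] g by simp
    thus "inv a \<otimes> g = g \<otimes> inv a" using a g by (simp add: inv_mult_group)
  qed (use a in simp)
  show "a \<otimes> b \<in> centre G" if a: "a \<in> centre G" and b: "b \<in> centre G" for a b
  proof (rule centreI)
    fix g assume g: "g \<in> carrier G"
    have "a \<otimes> b \<otimes> g = a \<otimes> (g \<otimes> b)" using a b g centreD[OF b g] by (simp add: m_assoc)
    also have "\<dots> = (a \<otimes> g) \<otimes> b" using a b g by (simp add: m_assoc)
    also have "\<dots> = g \<otimes> (a \<otimes> b)" unfolding centreD[OF a g] using a b g by (simp add: m_assoc)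
    finally show "a \<otimes> b \<otimes> g = g \<otimes> (a \<otimes> b)" .
  qed (use a b in simp)
qed

text \<open>The hypothesis places \<open>x\<close> in the second centre. In
  \<open>[x, gh] = [x, h] [x, g]^h\<close> the central values are fixed by the conjugation and may
  be interchanged.\<close>

lemma comm_elt_hom_right:
  assumes "x \<in> carrier G" "\<And>g. g \<in> carrier G \<Longrightarrow> comm_elt G x g \<in> centre G"
  shows "(\<lambda>g. comm_elt G x g) \<in> hom G G"
proof (rule homI)
  show "comm_elt G x (g \<otimes> h) = comm_elt G x g \<otimes> comm_elt G x h"
    if "g \<in> carrier G" "h \<in> carrier G" for g h
  proof -
    have "comm_elt G x (g \<otimes> h) = comm_elt G x h \<otimes> comm_elt G x g"
      using that assms by (simp add: comm_elt_mult_right centre_conj)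
    also have "\<dots> = comm_elt G x g \<otimes> comm_elt G x h"
      using that assms by (intro centreD) auto
    finally show ?thesis .
  qed
qed (use assms in simp)

lemma subgroup_nat_pow_closed:
  "subgroup A G \<Longrightarrow> x \<in> A \<Longrightarrow> x [^] (m::nat) \<in> A"
  by (induction m) (auto intro: subgroup.one_closed subgroup.m_closed)

lemma comm_elt_pow_left:
  assumes "x \<in> carrier G" "g \<in> carrier G" "comm_elt G x g \<in> centre G"
  shows "comm_elt G (x [^] (m::nat)) g = comm_elt G x g [^] m"
proof (induction m)
  case (Suc m)
  have "inv x \<otimes> comm_elt G x g [^] m \<otimes> x = comm_elt G x g [^] m"
    using assms by (intro centre_conj) (auto intro: subgroup_nat_pow_closed[OF centre_subgroup])
  thus ?case using assms Suc by (simp add: comm_elt_mult_left)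
qed (simp add: assms)

lemma comm_elt_pow_right:
  assumes "x \<in> carrier G" "g \<in> carrier G" "\<And>g. g \<in> carrier G \<Longrightarrow> comm_elt G x g \<in> centre G"
  shows "comm_elt G x (g [^] (m::nat)) = comm_elt G x g [^] m"
  using hom_nat_pow[OF comm_elt_hom_right[OF assms(1,3)] assms(2)] by (simp add: is_group)

lemma comm_elt_consistent:
  assumes "subgroup V G" "x \<in> V" "y \<in> V"
  shows "comm_elt (G\<lparr>carrier := V\<rparr>) x y = comm_elt G x y"
  using assms by (simp add: comm_elt_def)

text \<open>Induction over the hypercentre of \<open>G\<close>: for \<open>x\<close> and
  \<open>g\<close> in \<open>V\<close> the commutator stays in \<open>V\<close>, so the induction
  hypothesis applies to it.\<close>

lemma hypercentre_subgroup:
  assumes "x \<in> hypercentre G" "subgroup V G" "x \<in> V"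
  shows "x \<in> hypercentre (G\<lparr>carrier := V\<rparr>)"
  using assms(1,3)
proof (induction rule: hypercentre.induct)
  case (1 x)
  show ?case
  proof (rule hypercentre.intros)
    show "\<forall>g\<in>carrier (G\<lparr>carrier := V\<rparr>). comm_elt (G\<lparr>carrier := V\<rparr>) x g = \<one>\<^bsub>G\<lparr>carrier := V\<rparr>\<^esub> \<or>
            comm_elt (G\<lparr>carrier := V\<rparr>) x g \<in> hypercentre (G\<lparr>carrier := V\<rparr>)"
    proof
      fix g assume "g \<in> carrier (G\<lparr>carrier := V\<rparr>)"
      hence g: "g \<in> V" by simp
      have "comm_elt G x g \<in> V"
        unfolding comm_elt_def
        by (intro subgroup.m_closed[OF assms(2)] subgroup.m_inv_closed[OF assms(2)] g 1(3))
      moreover have "g \<in> carrier G" using subgroup.mem_carrier[OF assms(2) g] .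
      ultimately have "comm_elt G x g = \<one> \<or> comm_elt G x g \<in> hypercentre (G\<lparr>carrier := V\<rparr>)"
        using 1(2) by blast
      thus "comm_elt (G\<lparr>carrier := V\<rparr>) x g = \<one>\<^bsub>G\<lparr>carrier := V\<rparr>\<^esub> \<or>
            comm_elt (G\<lparr>carrier := V\<rparr>) x g \<in> hypercentre (G\<lparr>carrier := V\<rparr>)"
        using comm_elt_consistent[OF assms(2) 1(3) g] by simp
    qed
    show "x \<in> carrier (G\<lparr>carrier := V\<rparr>)" using 1(3) by simp
  qed
qed

lemma hypercentral_subgroup:
  assumes "hypercentral G" "subgroup V G"
  shows "hypercentral (G\<lparr>carrier := V\<rparr>)"
proof -
  have "V \<subseteq> hypercentre (G\<lparr>carrier := V\<rparr>)"
    using hypercentre_subgroup[OF _ assms(2)] assms subgroup.subset[OF assms(2)]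
    by (auto simp: hypercentral_def)
  moreover have "hypercentre (G\<lparr>carrier := V\<rparr>) \<subseteq> V"
    by (auto elim: hypercentre.cases)
  ultimately show ?thesis
    using subgroup_imp_group[OF assms(2)] by (auto simp: hypercentral_def)
qed

text \<open>This replaces transfinite induction along the upper central series.\<close>

lemma hypercentral_induct [consumes 2, case_names step]:
  assumes "hypercentral G" "x \<in> carrier G"
    and "\<And>x. \<lbrakk>x \<in> carrier G; \<And>g. g \<in> carrier G \<Longrightarrow> comm_elt G x g = \<one> \<or> P (comm_elt G x g)\<rbrakk> \<Longrightarrow> P x"
  shows "P x"
proof -
  have "x \<in> hypercentre G" using assms by (simp add: hypercentral_def)
  thus ?thesis
    by (induction rule: hypercentre.induct) (rule assms(3), blast+)
qed

text \<open>If the second centre is no larger than the centre, the upper central series stops there,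
  and hypercentrality makes the centre the whole group.\<close>

lemma centre_induct:
  assumes "hypercentral G"
    and "\<And>x. \<lbrakk>x \<in> carrier G; \<And>g. g \<in> carrier G \<Longrightarrow> comm_elt G x g \<in> centre G\<rbrakk> \<Longrightarrow> x \<in> centre G"
  shows "centre G = carrier G"
proof -
  have one: "\<one> \<in> centre G" using subgroup.one_closed[OF centre_subgroup] .
  have "x \<in> centre G" if "x \<in> carrier G" for x
    using assms(1) that
    by (induction rule: hypercentral_induct) (metis assms(2) one)
  thus ?thesis using centre_closed by blast
qed

end

lemma (in group_hom) hom_comm_elt:
  "\<lbrakk>x \<in> carrier G; y \<in> carrier G\<rbrakk> \<Longrightarrow> h (comm_elt G x y) = comm_elt H (h x) (h y)"
  by (simp add: comm_elt_def)

lemma (in group_hom) hypercentral_image: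
  assumes "hypercentral G" "h ` carrier G = carrier H"
  shows "hypercentral H"
proof -
  have "h x \<in> hypercentre H" if "x \<in> carrier G" for x
    using assms(1) that
  proof (induction rule: G.hypercentral_induct)
    case (step x)
    show ?case
    proof (rule hypercentre.intros)
      show "\<forall>g\<in>carrier H. comm_elt H (h x) g = \<one>\<^bsub>H\<^esub> \<or> comm_elt H (h x) g \<in> hypercentre H"
        unfolding assms(2)[symmetric] using step by (metis hom_comm_elt hom_one imageE)
    qed (use step in auto)
  qed
  hence "carrier H \<subseteq> hypercentre H" unfolding assms(2)[symmetric] by (rule image_subsetI)
  thus ?thesis
    by (auto simp: hypercentral_def elim: hypercentre.cases)
qed

section \<open>Torsion elements of hypercentral groups\<close>

context group
begin

lemma power_torsion_one [simp]: "power_torsion G n \<one>"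
  by (simp add: power_torsion_def)

lemma pow_power_mono:
  assumes "x [^] (n ^ k :: nat) = \<one>" "x \<in> carrier G" "k \<le> l"
  shows "x [^] (n ^ l :: nat) = \<one>"
proof -
  have "x [^] (n ^ l) = (x [^] (n ^ k)) [^] (n ^ (l - k))"
    using assms(2,3) by (simp add: nat_pow_pow flip: power_add)
  thus ?thesis using assms by simp
qed

lemma power_torsion_mult:
  assumes "power_torsion G n x" "power_torsion G n y" "x \<in> carrier G" "y \<in> carrier G"
    and "x \<otimes> y = y \<otimes> x"
  shows "power_torsion G n (x \<otimes> y)"
proof -
  obtain k l where k: "x [^] (n ^ k) = \<one>" and l: "y [^] (n ^ l) = \<one>"
    using assms by (auto simp: power_torsion_def)
  have "x [^] (n ^ (k + l)) = \<one>" "y [^] (n ^ (k + l)) = \<one>"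
    using pow_power_mono[OF k] pow_power_mono[OF l] assms by simp_all
  hence "(x \<otimes> y) [^] (n ^ (k + l)) = \<one>"
    using assms by (simp add: pow_mult_distrib)
  thus ?thesis unfolding power_torsion_def by blast
qed

lemma power_torsion_inv:
  "power_torsion G n x \<Longrightarrow> x \<in> carrier G \<Longrightarrow> power_torsion G n (inv x)"
  unfolding power_torsion_def by (metis inv_one nat_pow_inv)

lemma power_torsion_conj:
  assumes "power_torsion G n x" "x \<in> carrier G" "g \<in> carrier G"
  shows "power_torsion G n (g \<otimes> x \<otimes> inv g)"
proof -
  obtain k where "x [^] (n ^ k) = \<one>" using assms by (auto simp: power_torsion_def)
  hence "(g \<otimes> x \<otimes> inv g) [^] (n ^ k) = \<one>" using assms by (simp add: conj_pow)
  thus ?thesis unfolding power_torsion_def by blast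
qed

lemma generate_induct_subgroup:
  assumes "generate G Y = carrier G" "subgroup S G" "Y \<subseteq> S"
  shows "S = carrier G"
  using assms generate_subgroup_incl[OF assms(3,2)] subgroup.subset by blast

text \<open>For \<open>x\<close> in the second centre, the homomorphism
  \<open>g \<mapsto> [x, g]\<close> sends the generators in \<open>Y\<close> to central torsion
  elements, which are trivial. So \<open>x\<close> is central, the group is abelian, and the
  generators themselves are central torsion elements.\<close>

lemma generated_torsion_trivial:
  assumes "hypercentral G" "generate G Y = carrier G" "Y \<subseteq> carrier G"
    and tors: "\<And>x. x \<in> Y \<Longrightarrow> power_torsion G n x"
    and centre: "\<And>z. z \<in> centre G \<Longrightarrow> power_torsion G n z \<Longrightarrow> z = \<one>"
  shows "carrier G = {\<one>}"
proof -
  have abelian: "centre G = carrier G"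
    using assms(1)
  proof (rule centre_induct)
    fix x assume x: "x \<in> carrier G" and c: "\<And>g. g \<in> carrier G \<Longrightarrow> comm_elt G x g \<in> centre G"
    interpret \<theta>: group_hom G G "\<lambda>g. comm_elt G x g"
      using comm_elt_hom_right[OF x c] by unfold_locales
    have "subgroup (kernel G G (\<lambda>g. comm_elt G x g)) G" by (rule \<theta>.subgroup_kernel)
    moreover have "Y \<subseteq> kernel G G (\<lambda>g. comm_elt G x g)"
    proof
      fix y assume y: "y \<in> Y"
      then obtain k where "y [^] (n ^ k) = \<one>" using tors by (auto simp: power_torsion_def)
      hence "comm_elt G x y [^] (n ^ k) = \<one>"
        using y assms(3) x c by (subst comm_elt_pow_right[symmetric]) auto
      hence "power_torsion G n (comm_elt G x y)" by (auto simp: power_torsion_def)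
      thus "y \<in> kernel G G (\<lambda>g. comm_elt G x g)"
        using centre[OF c] y assms(3) by (auto simp: kernel_def)
    qed
    ultimately have "kernel G G (\<lambda>g. comm_elt G x g) = carrier G"
      by (rule generate_induct_subgroup[OF assms(2)])
    hence "\<forall>g\<in>carrier G. comm_elt G x g = \<one>" by (auto simp: kernel_def)
    thus "x \<in> centre G" using x by (intro centreI) (auto simp: comm_elt_eq_one_iff)
  qed
  have "Y \<subseteq> {\<one>}" using centre tors assms(3) abelian by blast
  thus ?thesis using generate_induct_subgroup[OF assms(2) triv_subgroup] by simp
qed

lemma central_torsion_normal:
  "{z \<in> centre G. power_torsion G n z} \<lhd> G"
proof (rule normal_invI)
  show "subgroup {z \<in> centre G. power_torsion G n z} G"
  proof (rule subgroupI)
    show "{z \<in> centre G. power_torsion G n z} \<noteq> {}"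
      using subgroup.one_closed[OF centre_subgroup] power_torsion_one by blast
    show "inv a \<in> {z \<in> centre G. power_torsion G n z}"
      if "a \<in> {z \<in> centre G. power_torsion G n z}" for a
      using that power_torsion_inv subgroup.m_inv_closed[OF centre_subgroup] by simp
    show "a \<otimes> b \<in> {z \<in> centre G. power_torsion G n z}"
      if "a \<in> {z \<in> centre G. power_torsion G n z}" "b \<in> {z \<in> centre G. power_torsion G n z}" for a b
      using that power_torsion_mult[of n a b] centreD[of a b] subgroup.m_closed[OF centre_subgroup] by simp
  qed auto
  show "x \<otimes> h \<otimes> inv x \<in> {z \<in> centre G. power_torsion G n z}"
    if "x \<in> carrier G" "h \<in> {z \<in> centre G. power_torsion G n z}" for x h
    using that centre_conj[of h "inv x"] by auto
qed

end

lemma (in group_hom) normal_vimage: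
  assumes "N \<lhd> H"
  shows "{x \<in> carrier G. h x \<in> N} \<lhd> G"
proof (rule G.normal_invI)
  interpret N: normal N H by fact
  show "subgroup {x \<in> carrier G. h x \<in> N} G"
  proof (rule G.subgroupI)
    have "\<one>\<^bsub>G\<^esub> \<in> {x \<in> carrier G. h x \<in> N}" by simp
    thus "{x \<in> carrier G. h x \<in> N} \<noteq> {}" by blast
  qed auto
  show "x \<otimes>\<^bsub>G\<^esub> y \<otimes>\<^bsub>G\<^esub> inv\<^bsub>G\<^esub> x \<in> {x \<in> carrier G. h x \<in> N}"
    if "x \<in> carrier G" "y \<in> {x \<in> carrier G. h x \<in> N}" for x y
    using that by (auto simp: N.inv_op_closed2)
qed

context group
begin

lemma Union_chain_subgroup:
  assumes "c \<noteq> {}" "\<And>A. A \<in> c \<Longrightarrow> subgroup A G"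
    and "\<And>A B. A \<in> c \<Longrightarrow> B \<in> c \<Longrightarrow> A \<subseteq> B \<or> B \<subseteq> A"
  shows "subgroup (\<Union>c) G"
proof (rule subgroupI)
  show "\<Union>c \<subseteq> carrier G" using assms(2) subgroup.subset by blast
  show "\<Union>c \<noteq> {}" using assms(1,2) subgroup.one_closed by blast
  show "inv a \<in> \<Union>c" if "a \<in> \<Union>c" for a using that assms(2) by (meson UnionE UnionI subgroup.m_inv_closed)
  show "a \<otimes> b \<in> \<Union>c" if ab: "a \<in> \<Union>c" "b \<in> \<Union>c" for a b
  proof -
    obtain A B where "a \<in> A" "b \<in> B" "A \<in> c" "B \<in> c" using ab by blast
    then obtain D where "a \<in> D" "b \<in> D" "D \<in> c" using assms(3)[of A B] by blast
    thus ?thesis using assms(2) by (meson UnionI subgroup.m_closed)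
  qed
qed

text \<open>Zorn's lemma gives a maximal normal subgroup \<open>P\<close> of elements of
  \<open>n\<close>-power order. The quotient by \<open>P\<close> has no nontrivial central torsion,
  as its preimage would enlarge \<open>P\<close>; hence \<open>generated_torsion_trivial\<close>
  collapses the quotient.\<close>

theorem hypercentral_generated_torsion:
  assumes "hypercentral G" "generate G Y = carrier G" "Y \<subseteq> carrier G"
    and tors: "\<And>x. x \<in> Y \<Longrightarrow> power_torsion G n x"
    and g: "g \<in> carrier G"
  shows "power_torsion G n g"
proof -
  define \<A> where "\<A> = {N. N \<lhd> G \<and> (\<forall>x\<in>N. power_torsion G n x)}"
  have "\<exists>P\<in>\<A>. \<forall>N\<in>\<A>. P \<subseteq> N \<longrightarrow> N = P"
  proof (rule subset_Zorn_nonempty)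
    show "\<A> \<noteq> {}" using one_is_normal by (auto simp: \<A>_def)
    fix c assume c: "c \<noteq> {}" "subset.chain \<A> c"
    have N: "N \<lhd> G" if "N \<in> c" for N using c that by (auto simp: subset.chain_def \<A>_def)
    have "\<Union>c \<lhd> G"
    proof (rule normal_invI)
      show "subgroup (\<Union>c) G"
      proof (rule Union_chain_subgroup)
        show "A \<subseteq> B \<or> B \<subseteq> A" if "A \<in> c" "B \<in> c" for A B
          using c that unfolding subset.chain_def by blast
      qed (use c N normal_imp_subgroup in auto)
      show "x \<otimes> h \<otimes> inv x \<in> \<Union>c" if "x \<in> carrier G" "h \<in> \<Union>c" for x h
        using that N normal.inv_op_closed2 by fastforce
    qed
    moreover have "\<forall>x\<in>\<Union>c. power_torsion G n x"
      using c by (auto simp: subset.chain_def \<A>_def)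
    ultimately show "\<Union>c \<in> \<A>" by (simp add: \<A>_def)
  qed
  then obtain P where P: "P \<lhd> G" "\<And>x. x \<in> P \<Longrightarrow> power_torsion G n x"
    and max: "\<And>N. N \<lhd> G \<Longrightarrow> \<forall>x\<in>N. power_torsion G n x \<Longrightarrow> P \<subseteq> N \<Longrightarrow> N = P"
    by (auto simp: \<A>_def)
  interpret P: normal P G by fact
  interpret Q: group "G Mod P" by (rule P.factorgroup_is_group)
  interpret \<phi>: group_hom G "G Mod P" "\<lambda>x. P #> x"
    using P.r_coset_hom_Mod by unfold_locales
  have surj: "(\<lambda>x. P #> x) ` carrier G = carrier (G Mod P)" by (simp add: carrier_FactGroup)
  \<comment> \<open>An extension of torsion by torsion is torsion: a power of \<open>z\<close> falls
    into \<open>P\<close>, and a further power is trivial.\<close>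
  have pow: "power_torsion G n z" if z: "power_torsion (G Mod P) n (P #> z)" "z \<in> carrier G" for z
  proof -
    obtain k where "(P #> z) [^]\<^bsub>G Mod P\<^esub> (n ^ k) = P"
      using z by (auto simp: power_torsion_def)
    hence "P #> (z [^] (n ^ k)) = P" using that by (simp add: \<phi>.hom_nat_pow)
    hence "z [^] (n ^ k) \<in> P"
      using that coset_join1 P.subgroup_axioms P.subset by (metis nat_pow_closed)
    then obtain l where "(z [^] (n ^ k)) [^] (n ^ l) = \<one>" using P(2) by (auto simp: power_torsion_def)
    hence "z [^] (n ^ (k + l)) = \<one>" using that by (simp add: nat_pow_pow power_add)
    thus ?thesis by (auto simp: power_torsion_def)
  qed
  have "carrier (G Mod P) = {\<one>\<^bsub>G Mod P\<^esub>}"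
  proof (rule Q.generated_torsion_trivial)
    show "hypercentral (G Mod P)" by (rule \<phi>.hypercentral_image[OF assms(1) surj])
    show "generate (G Mod P) ((\<lambda>x. P #> x) ` Y) = carrier (G Mod P)"
      using \<phi>.generate_img[OF assms(3)] assms(2) surj by simp
    show "(\<lambda>x. P #> x) ` Y \<subseteq> carrier (G Mod P)" using assms(3) \<phi>.hom_closed by blast
    show "power_torsion (G Mod P) n y" if y: "y \<in> (\<lambda>x. P #> x) ` Y" for y
    proof -
      obtain x where x: "x \<in> Y" "y = P #> x" using y by blast
      then obtain k where "x [^] (n ^ k) = \<one>" using tors by (auto simp: power_torsion_def)
      hence "y [^]\<^bsub>G Mod P\<^esub> (n ^ k) = \<one>\<^bsub>G Mod P\<^esub>"
        using x assms(3) by (metis \<phi>.hom_nat_pow \<phi>.hom_one subsetD)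
      thus ?thesis unfolding power_torsion_def by blast
    qed
    show "z = \<one>\<^bsub>G Mod P\<^esub>" if z: "z \<in> centre (G Mod P)" "power_torsion (G Mod P) n z" for z
    proof -
      let ?Z = "{z \<in> centre (G Mod P). power_torsion (G Mod P) n z}"
      let ?T = "{x \<in> carrier G. P #> x \<in> ?Z}"
      have one: "P \<in> ?Z"
        using Q.power_torsion_one subgroup.one_closed[OF Q.centre_subgroup] by simp
      have "?T = P"
      proof (rule max)
        show "?T \<lhd> G" by (rule \<phi>.normal_vimage[OF Q.central_torsion_normal])
        show "\<forall>x\<in>?T. power_torsion G n x" using pow by blast
        show "P \<subseteq> ?T" using one P.subset P.rcos_const by auto
      qed
      moreover obtain x where "x \<in> carrier G" "z = P #> x"
        using z(1) surj Q.centre_closed by blast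
      ultimately show ?thesis using z P.rcos_const by auto
    qed
  qed
  hence "P #> g = P" using surj g by auto
  hence "g \<in> P" using g coset_join1 P.subgroup_axioms P.subset by metis
  thus ?thesis by (rule P(2))
qed

end

section \<open>Subgroups of finite index\<close>

text \<open>For a subgroup \<open>B\<close> of \<open>A\<close> this says that \<open>B\<close> has finite index in \<open>A\<close>.\<close>
definition finite_cover :: "('a, 'b) monoid_scheme \<Rightarrow> 'a set \<Rightarrow> 'a set \<Rightarrow> bool" where
  "finite_cover G A B \<longleftrightarrow> (\<exists>F. finite F \<and> F \<subseteq> carrier G \<and> A \<subseteq> B <#>\<^bsub>G\<^esub> F)"

context group
begin

lemma subset_set_mult:
  assumes "subgroup A G" "subgroup B G"
  shows "A \<subseteq> A <#> B" "B \<subseteq> A <#> B"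
proof -
  interpret A: subgroup A G by fact
  interpret B: subgroup B G by fact
  show "A \<subseteq> A <#> B"
  proof
    fix x assume "x \<in> A"
    hence "x = x \<otimes> \<one>" "x \<in> A" by simp_all
    thus "x \<in> A <#> B" using B.one_closed unfolding set_mult_def by blast
  qed
  show "B \<subseteq> A <#> B"
  proof
    fix x assume "x \<in> B"
    hence "x = \<one> \<otimes> x" "x \<in> B" by simp_all
    thus "x \<in> A <#> B" using A.one_closed unfolding set_mult_def by blast
  qed
qed

text \<open>The hypothesis \<open>norm\<close> says that \<open>M\<close> is its own normalizer. If
  all commutators \<open>[x, g]\<close> lie in \<open>M\<close>, then
  \<open>x m x^-1 = m [x, x m x^-1]\<close> shows that \<open>x\<close> normalizes \<open>M\<close>,
  so induction over the hypercentre puts every \<open>x\<close> into \<open>M\<close>.\<close>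

lemma normalizer_condition:
  assumes "hypercentral G" "subgroup M G"
    and norm: "\<And>x. \<lbrakk>x \<in> carrier G; \<And>m. m \<in> M \<Longrightarrow> x \<otimes> m \<otimes> inv x \<in> M;
                \<And>m. m \<in> M \<Longrightarrow> inv x \<otimes> m \<otimes> x \<in> M\<rbrakk> \<Longrightarrow> x \<in> M"
  shows "M = carrier G"
proof -
  interpret M: subgroup M G by fact
  have "x \<in> M" if "x \<in> carrier G" for x
    using assms(1) that
  proof (induction rule: hypercentral_induct)
    case (step x)
    hence c: "comm_elt G x g \<in> M" if "g \<in> carrier G" for g
      using that by fastforce
    show ?case
    proof (rule norm)
      fix m assume m: "m \<in> M"
      hence "m \<in> carrier G" by simp
      have "x \<otimes> m \<otimes> inv x = m \<otimes> comm_elt G x (x \<otimes> m \<otimes> inv x)"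
        using step \<open>m \<in> carrier G\<close> by (simp add: comm_elt_def word_simps)
      thus "x \<otimes> m \<otimes> inv x \<in> M"
        using M.m_closed[OF m c[of "x \<otimes> m \<otimes> inv x"]] step(1) \<open>m \<in> carrier G\<close> by simp
      have "inv x \<otimes> m \<otimes> x = comm_elt G x (inv m) \<otimes> m"
        using step \<open>m \<in> carrier G\<close> by (simp add: comm_elt_def word_simps)
      thus "inv x \<otimes> m \<otimes> x \<in> M"
        using c[of "inv m"] m \<open>m \<in> carrier G\<close> by simp
    qed (use step in simp)
  qed
  thus ?thesis using M.subset by blast
qed

text \<open>Both conjugations are required: for infinite \<open>M\<close>, the inclusion of
  \<open>x M x^-1\<close> in \<open>M\<close> alone is not inherited by
  \<open>inv x\<close>.\<close>

lemma normalizer_subgroup: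
  assumes "M \<subseteq> carrier G"
  shows "subgroup {x \<in> carrier G. \<forall>m\<in>M. x \<otimes> m \<otimes> inv x \<in> M \<and> inv x \<otimes> m \<otimes> x \<in> M} G"
    (is "subgroup ?N G")
proof (rule subgroupI)
  have "\<one> \<in> ?N" using assms by auto
  thus "?N \<noteq> {}" by blast
  show "a \<otimes> b \<in> ?N" if a: "a \<in> ?N" and b: "b \<in> ?N" for a b
  proof -
    have "a \<otimes> b \<otimes> m \<otimes> inv (a \<otimes> b) \<in> M \<and> inv (a \<otimes> b) \<otimes> m \<otimes> (a \<otimes> b) \<in> M" if m: "m \<in> M" for m
    proof -
      have mc: "m \<in> carrier G" and ac: "a \<in> carrier G" and bc: "b \<in> carrier G"
        using m assms a b by auto
      have "a \<otimes> (b \<otimes> m \<otimes> inv b) \<otimes> inv a \<in> M" "inv b \<otimes> (inv a \<otimes> m \<otimes> a) \<otimes> b \<in> M"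
        using a b m by simp_all
      thus ?thesis using mc ac bc by (simp add: word_simps)
    qed
    thus ?thesis using a b by simp
  qed
qed auto

text \<open>A hypercentral group has no proper self-normalizing subgroup, so the normalizer of
  \<open>M\<close> is strictly larger than \<open>M\<close> and, by maximality, everything.\<close>

lemma maximal_subgroup_normal:
  assumes "hypercentral G" "subgroup M G" "M \<noteq> carrier G"
    and max: "\<And>L. \<lbrakk>subgroup L G; M \<subseteq> L; L \<noteq> M\<rbrakk> \<Longrightarrow> L = carrier G"
  shows "M \<lhd> G"
proof -
  interpret M: subgroup M G by fact
  let ?N = "{x \<in> carrier G. \<forall>m\<in>M. x \<otimes> m \<otimes> inv x \<in> M \<and> inv x \<otimes> m \<otimes> x \<in> M}"
  have "?N \<noteq> M" using normalizer_condition[OF assms(1,2)] assms(3) by blast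
  moreover have "M \<subseteq> ?N" using M.subset by auto
  ultimately have "?N = carrier G" using max[OF normalizer_subgroup[OF M.subset]] by blast
  thus ?thesis by (intro normal_invI[OF assms(2)]) blast
qed

section \<open>Contranormality and subgroups of finite index\<close>

lemma normal_closure_subset:
  assumes "N \<lhd> G" "H \<subseteq> N"
  shows "normal_closure G H \<subseteq> N"
  unfolding normal_closure_def
proof (rule generate_subgroup_incl)
  show "(\<Union>g\<in>carrier G. (\<lambda>h. g \<otimes> h \<otimes> inv g) ` H) \<subseteq> N"
    using assms normal.inv_op_closed2[OF assms(1)] by blast
qed (rule normal_imp_subgroup[OF assms(1)])

lemma finite_coverE:
  assumes "finite_cover G A B"
  obtains F where "finite F" "F \<subseteq> carrier G" "A \<subseteq> B <#> F"
  using assms unfolding finite_cover_def by blast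

lemma finite_coverI: "\<lbrakk>finite F; F \<subseteq> carrier G; A \<subseteq> B <#> F\<rbrakk> \<Longrightarrow> finite_cover G A B"
  unfolding finite_cover_def by blast

lemma finite_set_mult: "finite A \<Longrightarrow> finite B \<Longrightarrow> finite (A <#> B)"
  unfolding set_mult_def by simp

lemma finite_cover_trans:
  assumes "finite_cover G A B" "finite_cover G B D" "D \<subseteq> carrier G"
  shows "finite_cover G A D"
proof -
  obtain F where F: "finite F" "F \<subseteq> carrier G" "A \<subseteq> B <#> F" using assms(1) by (rule finite_coverE)
  obtain F' where F': "finite F'" "F' \<subseteq> carrier G" "B \<subseteq> D <#> F'" using assms(2) by (rule finite_coverE)
  have "A \<subseteq> (D <#> F') <#> F" using F(3) mono_set_mult[OF F'(3) order_refl, of G F] by (meson order_trans)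
  hence "A \<subseteq> D <#> (F' <#> F)" using set_mult_assoc[OF assms(3) F'(2) F(2)] by simp
  thus ?thesis
    using F F' by (intro finite_coverI[OF finite_set_mult[OF F'(1) F(1)] setmult_subset_G]) auto
qed

text \<open>Were \<open>N <#> H\<close> proper, finite index would place it inside a maximal
  subgroup. That subgroup is normal and contains \<open>H\<close>, hence contains the normal closure
  of \<open>H\<close>, which is the whole group.\<close>

lemma finite_cover_carrier:
  assumes "finite_cover G (carrier G) N" "hypercentral G" "N \<lhd> G" "contranormal G H"
  shows "N <#> H = carrier G"
proof (rule ccontr)
  assume L: "N <#> H \<noteq> carrier G"
  have H: "subgroup H G" and HG: "normal_closure G H = carrier G"
    using assms(4) by (auto simp: contranormal_def)
  have NH: "subgroup (N <#> H) G" by (rule mult_norm_subgroup[OF assms(3) H])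
  have Nsub: "subgroup N G" by (rule normal_imp_subgroup[OF assms(3)])
  obtain F where F: "finite F" "F \<subseteq> carrier G" "carrier G \<subseteq> N <#> F"
    using assms(1) by (rule finite_coverE)
  let ?P = "\<lambda>M. subgroup M G \<and> N <#> H \<subseteq> M \<and> M \<noteq> carrier G"
  \<comment> \<open>A maximal subgroup is found by counting: a subgroup containing \<open>N\<close>
    is determined by the representatives in \<open>F\<close> that it contains, and their number is
    at most \<open>card F\<close>.\<close>
  have "\<exists>M. ?P M \<and> (\<forall>L. ?P L \<longrightarrow> card (L \<inter> F) \<le> card (M \<inter> F))"
  proof (rule ex_has_greatest_nat[where f = "\<lambda>M. card (M \<inter> F)" and P = ?P])
    show "?P (N <#> H)" using NH L by simp
    show "\<forall>M. ?P M \<longrightarrow> card (M \<inter> F) < Suc (card F)"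
      using F(1) by (simp add: card_mono less_Suc_eq_le)
  qed
  then obtain M where M: "subgroup M G" "N <#> H \<subseteq> M" "M \<noteq> carrier G"
    and max: "\<And>L. ?P L \<Longrightarrow> card (L \<inter> F) \<le> card (M \<inter> F)" by blast
  interpret M: subgroup M G by fact
  have NM: "N \<subseteq> N <#> H" and HM: "H \<subseteq> N <#> H" by (rule subset_set_mult[OF Nsub H])+
  have "M \<lhd> G"
  proof (rule maximal_subgroup_normal[OF assms(2) M(1,3)])
    fix L assume L: "subgroup L G" "M \<subseteq> L" "L \<noteq> M"
    interpret L: subgroup L G by fact
    show "L = carrier G"
    proof (rule ccontr)
      assume "L \<noteq> carrier G"
      hence "card (L \<inter> F) \<le> card (M \<inter> F)" using max L M by blast
      moreover have "M \<inter> F \<subseteq> L \<inter> F" using L by blast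
      ultimately have eq: "L \<inter> F = M \<inter> F" using F(1) by (metis card_seteq finite_Int)
      have "L \<subseteq> M"
      proof
        fix x assume x: "x \<in> L"
        then obtain a f where af: "a \<in> N" "f \<in> F" "x = a \<otimes> f"
          using F(3) L.subset unfolding set_mult_def by blast
        have a: "a \<in> M" using af NM M(2) by blast
        have "f = inv a \<otimes> x" using af a F(2) by (simp add: subsetD l_inv_cancel)
        hence "f \<in> L" using x a L(2) by blast
        hence "f \<in> M" using eq af by blast
        thus "x \<in> M" using a af by simp
      qed
      thus False using L by blast
    qed
  qed
  hence "normal_closure G H \<subseteq> M" using HM M(2) by (intro normal_closure_subset) auto
  thus False using HG M(3) M.subset by blast
qed

text \<open>\<open>N\<close> is the kernel of the action of \<open>G\<close> by right multiplication
  on the right cosets of \<open>M\<close>. There are finitely many cosets, hence finitely many maps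
  between them, so the kernel has finite index.\<close>

lemma finite_cover_core:
  assumes "subgroup M G" "finite_cover G (carrier G) M"
  obtains N where "N \<lhd> G" "N \<subseteq> M" "finite_cover G (carrier G) N"
proof
  interpret M: subgroup M G by fact
  obtain F where F: "finite F" "F \<subseteq> carrier G" "carrier G \<subseteq> M <#> F"
    using assms(2) by (rule finite_coverE)
  let ?R = "rcosets M"
  define N where "N = {g \<in> carrier G. \<forall>Y\<in>?R. Y #> g = Y}"
  have "?R \<subseteq> (\<lambda>f. M #> f) ` F"
  proof
    fix Y assume "Y \<in> ?R"
    then obtain g where g: "g \<in> carrier G" "Y = M #> g" unfolding RCOSETS_def by blast
    then obtain m f where "m \<in> M" "f \<in> F" "g = m \<otimes> f" using F(3) unfolding set_mult_def by blast
    moreover have "M #> (m \<otimes> f) = M #> f"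
      using calculation F(2) M.rcos_const by (metis M.mem_carrier M.subset coset_mult_assoc is_group subsetD)
    ultimately show "Y \<in> (\<lambda>f. M #> f) ` F" using g by blast
  qed
  hence finR: "finite ?R" using F(1) finite_surj by blast
  have Rc: "Y \<subseteq> carrier G" if "Y \<in> ?R" for Y using that by (rule M.rcosets_carrier[OF is_group])
  have Rm: "Y #> g \<in> ?R" if "Y \<in> ?R" "g \<in> carrier G" for Y g
    using that M.subset unfolding RCOSETS_def by (auto simp: coset_mult_assoc)
  have sub: "subgroup N G"
  proof (rule subgroupI)
    have "\<one> \<in> N" using Rc by (simp add: N_def)
    thus "N \<noteq> {}" by blast
    show "a \<otimes> b \<in> N" if "a \<in> N" "b \<in> N" for a b
      using that Rc by (auto simp: N_def coset_mult_assoc[symmetric])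
    show "inv a \<in> N" if "a \<in> N" for a
    proof -
      have "Y #> inv a = Y" if "Y \<in> ?R" for Y
      proof -
        have "Y #> inv a = (Y #> a) #> inv a" using that \<open>a \<in> N\<close> by (simp add: N_def)
        also have "\<dots> = Y" using Rc[OF that] \<open>a \<in> N\<close> unfolding N_def by (simp add: coset_mult_assoc del: Ball_def)
        finally show ?thesis .
      qed
      thus ?thesis using that by (simp add: N_def)
    qed
  qed (auto simp: N_def)
  show "N \<lhd> G"
  proof (rule normal_invI[OF sub])
    fix x h assume x: "x \<in> carrier G" and h: "h \<in> N"
    have hc: "h \<in> carrier G" using h by (simp add: N_def)
    have "Y #> (x \<otimes> h \<otimes> inv x) = Y" if Y: "Y \<in> ?R" for Y
    proof -
      have "Y #> (x \<otimes> h \<otimes> inv x) = ((Y #> x) #> h) #> inv x"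
        using x hc Rc[OF Y] by (simp add: coset_mult_assoc r_coset_subset_G)
      also have "(Y #> x) #> h = Y #> x" using h Rm[OF Y x] by (simp add: N_def)
      finally show ?thesis using x Rc[OF Y] by (simp add: coset_mult_assoc)
    qed
    thus "x \<otimes> h \<otimes> inv x \<in> N" using x hc by (simp add: N_def)
  qed
  show "N \<subseteq> M"
  proof
    fix g assume "g \<in> N"
    hence g: "g \<in> carrier G" "M #> g = M"
      using M.subgroup_in_rcosets[OF is_group] by (auto simp: N_def)
    thus "g \<in> M" by (metis M.subgroup_axioms M.subset coset_join1)
  qed
  \<comment> \<open>Restricting to \<open>?R\<close> puts the maps into a finite function space;
    finitely many group elements \<open>E\<close> then realise all of them.\<close>
  let ?\<phi> = "\<lambda>g. restrict (\<lambda>Y. Y #> g) ?R"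
  have "?\<phi> ` carrier G \<subseteq> ?R \<rightarrow>\<^sub>E ?R" using Rm by auto
  hence "finite (?\<phi> ` carrier G)" using finR by (meson finite_PiE finite_subset)
  then obtain E where E: "finite E" "E \<subseteq> carrier G" "?\<phi> ` carrier G = ?\<phi> ` E"
    by (meson finite_subset_image order_refl)
  have "carrier G \<subseteq> N <#> E"
  proof
    fix g assume g: "g \<in> carrier G"
    then obtain e where e: "e \<in> E" "?\<phi> g = ?\<phi> e" using E(3) by blast
    hence ec: "e \<in> carrier G" using E(2) by blast
    have "Y #> (g \<otimes> inv e) = Y" if Y: "Y \<in> ?R" for Y
    proof -
      have "Y #> g = Y #> e" using fun_cong[OF e(2), of Y] Y by simp
      hence "Y #> (g \<otimes> inv e) = (Y #> e) #> inv e"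
        using g ec Rc[OF Y] by (simp add: coset_mult_assoc[symmetric])
      thus ?thesis using ec Rc[OF Y] by (simp add: coset_mult_assoc)
    qed
    hence "g \<otimes> inv e \<in> N" using g ec by (simp add: N_def)
    moreover have "g = (g \<otimes> inv e) \<otimes> e" using g ec by (simp add: m_assoc)
    ultimately show "g \<in> N <#> E" using e unfolding set_mult_def by blast
  qed
  thus "finite_cover G (carrier G) N" by (rule finite_coverI[OF E(1,2)])
qed

text \<open>\<open>V\<close> is the least normal subgroup of finite index; it exists because \<open>H\<close> maps onto every
  finite quotient, which bounds the index.\<close>
theorem no_proper_finite_index_subgroup:
  assumes "hypercentral G" "contranormal G H" "finite H"
  obtains V where "V \<lhd> G" "V <#> H = carrier G"
    "\<And>M. \<lbrakk>subgroup M G; M \<subseteq> V; finite_cover G V M\<rbrakk> \<Longrightarrow> M = V"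
proof -
  have H: "subgroup H G" using assms(2) by (simp add: contranormal_def)
  let ?P = "\<lambda>N. N \<lhd> G \<and> finite_cover G (carrier G) N"
  have "carrier G \<subseteq> carrier G <#> {\<one>}" unfolding set_mult_def by auto
  hence "?P (carrier G)"
    using finite_coverI[of "{\<one>}" "carrier G" "carrier G"] normal_invI[OF subgroup_self] by auto
  \<comment> \<open>\<open>H\<close> maps onto each finite quotient \<open>G/N\<close> with kernel
    \<open>N \<inter> H\<close>, so making \<open>card (N \<inter> H)\<close> least makes the index
    greatest.\<close>
  then obtain V where V: "V \<lhd> G" "finite_cover G (carrier G) V"
    and min: "\<And>N. ?P N \<Longrightarrow> card (V \<inter> H) \<le> card (N \<inter> H)"
    using ex_has_least_nat[of ?P "carrier G" "\<lambda>N. card (N \<inter> H)"] by blast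
  interpret V: normal V G by fact
  show ?thesis
  proof (rule that[OF V(1)])
    show "V <#> H = carrier G" by (rule finite_cover_carrier[OF V(2) assms(1) V(1) assms(2)])
    fix M assume M: "subgroup M G" "M \<subseteq> V" "finite_cover G V M"
    have "finite_cover G (carrier G) M"
      by (rule finite_cover_trans[OF V(2) M(3) subgroup.subset[OF M(1)]])
    then obtain N where N: "N \<lhd> G" "N \<subseteq> M" "finite_cover G (carrier G) N"
      using finite_cover_core[OF M(1)] by blast
    interpret N: normal N G by fact
    have NH: "N <#> H = carrier G" by (rule finite_cover_carrier[OF N(3) assms(1) N(1) assms(2)])
    have "N \<inter> H \<subseteq> V \<inter> H" using N M by blast
    hence eq: "N \<inter> H = V \<inter> H"
      using min N assms(3) by (metis card_seteq finite_Int)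
    \<comment> \<open>Dedekind's law: \<open>V = N (V \<inter> H)\<close>, and
      \<open>V \<inter> H\<close> lies in \<open>N\<close>.\<close>
    have "V \<subseteq> N"
    proof
      fix v assume v: "v \<in> V"
      hence "v \<in> N <#> H" using NH by simp
      then obtain a h where ah: "a \<in> N" "h \<in> H" "v = a \<otimes> h" unfolding set_mult_def by blast
      have "h = inv a \<otimes> v" using ah subgroup.mem_carrier[OF H] by (simp add: l_inv_cancel)
      moreover have "a \<in> V" using ah N M by blast
      ultimately have "h \<in> V" using v by simp
      hence "h \<in> N" using eq ah by blast
      thus "v \<in> N" using ah by simp
    qed
    thus "M = V" using N M by blast
  qed
qed

section \<open>Groups without proper subgroups of finite index\<close>

lemma normal_of_comm_elt_mem:
  assumes "subgroup M G" "\<And>u v. u \<in> carrier G \<Longrightarrow> v \<in> carrier G \<Longrightarrow> comm_elt G u v \<in> M"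
  shows "M \<lhd> G"
proof (rule normal_invI[OF assms(1)])
  interpret M: subgroup M G by fact
  fix g m assume g: "g \<in> carrier G" "m \<in> M"
  have "g \<otimes> m \<otimes> inv g = m \<otimes> comm_elt G m (inv g)"
    using g by (simp add: comm_elt_def word_simps)
  moreover have "m \<otimes> comm_elt G m (inv g) \<in> M" using g assms(2) by (intro M.m_closed) auto
  ultimately show "g \<otimes> m \<otimes> inv g \<in> M" by simp
qed

text \<open>The quotient by \<open>K\<close> is elementary abelian of exponent \<open>p\<close>. If
  it is nontrivial, a subgroup maximal with respect to avoiding a given nontrivial element has index
  \<open>p\<close>, contrary to \<open>nofi\<close>.\<close>

lemma no_finite_index_prime:
  assumes nofi: "\<And>M. \<lbrakk>subgroup M G; finite_cover G (carrier G) M\<rbrakk> \<Longrightarrow> M = carrier G"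
    and K: "subgroup K G"
    and comm: "\<And>u v. u \<in> carrier G \<Longrightarrow> v \<in> carrier G \<Longrightarrow> comm_elt G u v \<in> K"
    and p: "Factorial_Ring.prime (p::nat)"
    and pow: "\<And>v. v \<in> carrier G \<Longrightarrow> v [^] p \<in> K"
  shows "K = carrier G"
proof (rule ccontr)
  assume "K \<noteq> carrier G"
  then obtain x where x: "x \<in> carrier G" "x \<notin> K" using subgroup.subset[OF K] by blast
  define \<A> where "\<A> = {M. subgroup M G \<and> K \<subseteq> M \<and> x \<notin> M}"
  have "\<exists>M\<in>\<A>. \<forall>N\<in>\<A>. M \<subseteq> N \<longrightarrow> N = M"
  proof (rule subset_Zorn_nonempty)
    show "\<A> \<noteq> {}" using K x by (auto simp: \<A>_def)
    fix c assume c: "c \<noteq> {}" "subset.chain \<A> c"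
    have "subgroup (\<Union>c) G"
    proof (rule Union_chain_subgroup[OF c(1)])
      show "A \<subseteq> B \<or> B \<subseteq> A" if "A \<in> c" "B \<in> c" for A B
        using c that unfolding subset.chain_def by blast
      show "subgroup A G" if "A \<in> c" for A
        using c that unfolding subset.chain_def \<A>_def by blast
    qed
    moreover have "K \<subseteq> \<Union>c" "x \<notin> \<Union>c" using c unfolding subset.chain_def \<A>_def by blast+
    ultimately show "\<Union>c \<in> \<A>" by (simp add: \<A>_def)
  qed
  then obtain M where "M \<in> \<A>" and max_\<A>: "\<And>N. N \<in> \<A> \<Longrightarrow> M \<subseteq> N \<Longrightarrow> N = M" by blast
  hence M: "subgroup M G" "K \<subseteq> M" "x \<notin> M" by (simp_all add: \<A>_def)
  have max: "N = M" if "subgroup N G" "M \<subseteq> N" "x \<notin> N" for N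
    using max_\<A>[of N] that M(2) by (simp add: \<A>_def)
  interpret M: subgroup M G by fact
  have Mn: "M \<lhd> G" using M(2) comm by (intro normal_of_comm_elt_mem[OF M(1)]) blast
  have gen: "subgroup (generate G {b}) G" if "b \<in> carrier G" for b
    using that by (intro generate_is_subgroup) auto
  define T where "T = M <#> generate G {x}"
  have T: "subgroup T G" unfolding T_def by (rule mult_norm_subgroup[OF Mn gen[OF x(1)]])
  have MT: "M \<subseteq> T" unfolding T_def by (rule subset_set_mult[OF M(1) gen[OF x(1)]])
  have xT: "x \<in> T"
    using subset_set_mult(2)[OF M(1) gen[OF x(1)]] generate.incl[of x "{x}" G] unfolding T_def by blast
  have T_pow: "y [^] (i::int) \<in> T" if "y \<in> T" for y i by (rule subgroup_int_pow_closed[OF T that])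
  have "b \<in> T" if b: "b \<in> carrier G" for b
  proof (cases "b \<in> M")
    case True thus ?thesis using MT by blast
  next
    case False
    let ?L = "M <#> generate G {b}"
    have "b \<in> ?L"
      using subset_set_mult(2)[OF M(1) gen[OF b]] generate.incl[of b "{b}" G] by blast
    hence "?L \<noteq> M" using False by blast
    hence "x \<in> ?L"
      using max[OF mult_norm_subgroup[OF Mn gen[OF b]] subset_set_mult(1)[OF M(1) gen[OF b]]] by blast
    then obtain m i where mi: "m \<in> M" "x = m \<otimes> b [^] (i::int)"
      unfolding set_mult_def generate_pow[OF b] by blast
    have bp: "b [^] int p \<in> M" using pow[OF b] M(2) by (auto simp: int_pow_int)
    \<comment> \<open>If \<open>p\<close> divided \<open>i\<close>, then \<open>b [^] i\<close> and
      hence \<open>x\<close> would lie in \<open>M\<close>. So \<open>i\<close> is invertible modulo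
      \<open>p\<close>, and Bezout expresses \<open>b\<close> through \<open>b [^] int p\<close> and
      \<open>b [^] i\<close>, both in \<open>T\<close>.\<close>
    have "\<not> int p dvd i"
    proof
      assume "int p dvd i"
      then obtain j where "i = int p * j" by (rule dvdE)
      hence "b [^] i = (b [^] int p) [^] j" using b by (simp add: int_pow_pow)
      hence "b [^] i \<in> M" using subgroup_int_pow_closed[OF M(1) bp] by simp
      thus False using mi M(3) by simp
    qed
    hence "coprime (int p) i" using p by (intro prime_imp_coprime) auto
    then obtain u w where uw: "u * int p + w * i = 1"
      using bezout_int[of "int p" i] by (auto simp: coprime_iff_gcd_eq_1)
    have bi: "b [^] i \<in> T"
    proof -
      have "b [^] i = inv m \<otimes> x" using mi b by (simp add: l_inv_cancel)
      moreover have "inv m \<otimes> x \<in> T"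
        using mi(1) MT by (intro subgroup.m_closed[OF T] subgroup.m_inv_closed[OF T] xT) blast
      ultimately show ?thesis by simp
    qed
    have "b = b [^] (int p * u + i * w)" using uw b by (simp add: mult.commute)
    also have "\<dots> = (b [^] int p) [^] u \<otimes> (b [^] i) [^] w" using b by (simp add: int_pow_mult int_pow_pow)
    also have "\<dots> \<in> T" by (rule subgroup.m_closed[OF T T_pow[OF subsetD[OF MT bp]] T_pow[OF bi]])
    finally show ?thesis .
  qed
  \<comment> \<open>\<open>x [^] int p\<close> lies in \<open>M\<close>, so the powers of
    \<open>x\<close> with exponent below \<open>p\<close> represent all cosets of \<open>M\<close>
    in \<open>T\<close>.\<close>
  moreover have "T \<subseteq> M <#> (\<lambda>r. x [^] r) ` {..<p}"
  proof
    fix t assume "t \<in> T"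
    then obtain m k where mk: "m \<in> M" "t = m \<otimes> x [^] (k::int)"
      unfolding T_def set_mult_def generate_pow[OF x(1)] by blast
    have p0: "int p > 0" using p prime_gt_0_nat by simp
    define r where "r = nat (k mod int p)"
    have r: "r < p" "k = int p * (k div int p) + int r" using p0 by (simp_all add: r_def nat_less_iff)
    have "x [^] k = x [^] (int p * (k div int p)) \<otimes> x [^] r"
      using x(1) by (subst r(2)) (simp add: int_pow_mult int_pow_int)
    moreover have "x [^] (int p * (k div int p)) = (x [^] int p) [^] (k div int p)"
      using x(1) by (simp add: int_pow_pow)
    moreover have xp: "x [^] int p \<in> M" using pow[OF x(1)] M(2) by (auto simp: int_pow_int)
    have "(x [^] int p) [^] (k div int p) \<in> M" by (rule subgroup_int_pow_closed[OF M(1) xp])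
    ultimately have "t = (m \<otimes> (x [^] int p) [^] (k div int p)) \<otimes> x [^] r"
      "m \<otimes> (x [^] int p) [^] (k div int p) \<in> M"
      using mk x(1) by (simp_all add: m_assoc)
    thus "t \<in> M <#> (\<lambda>r. x [^] r) ` {..<p}" using r(1) unfolding set_mult_def by blast
  qed
  ultimately have "carrier G \<subseteq> M <#> (\<lambda>r. x [^] r) ` {..<p}" by blast
  hence "finite_cover G (carrier G) M" using x(1) by (intro finite_coverI) auto
  hence "M = carrier G" by (rule nofi[OF M(1)])
  thus False using x(1) M(3) by blast
qed

text \<open>Descent on the exponent: for a prime \<open>p\<close> with \<open>N = p * m\<close>, the
  elements \<open>v\<close> with \<open>(\<theta> v)^m\<close> trivial form a subgroup containing
  all commutators and all \<open>p\<close>-th powers, so \<open>m\<close> is an exponent too.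
  Commutativity is asked of the image only, since the target is later a group not yet known to be
  abelian.\<close>

lemma no_finite_index_hom_trivial:
  assumes nofi: "\<And>M. \<lbrakk>subgroup M G; finite_cover G (carrier G) M\<rbrakk> \<Longrightarrow> M = carrier G"
    and hom: "group_hom G A \<theta>"
    and comm: "\<And>u v. u \<in> carrier G \<Longrightarrow> v \<in> carrier G \<Longrightarrow> \<theta> u \<otimes>\<^bsub>A\<^esub> \<theta> v = \<theta> v \<otimes>\<^bsub>A\<^esub> \<theta> u"
    and "N > (0::nat)" "\<And>v. v \<in> carrier G \<Longrightarrow> \<theta> v [^]\<^bsub>A\<^esub> N = \<one>\<^bsub>A\<^esub>"
    and "v \<in> carrier G"
  shows "\<theta> v = \<one>\<^bsub>A\<^esub>"
  using assms(4-)
proof (induction N arbitrary: v rule: less_induct)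
  case (less N)
  interpret \<theta>: group_hom G A \<theta> by fact
  show ?case
  proof (cases "N = 1")
    case True thus ?thesis using less.prems(2)[OF less.prems(3)] less.prems(3) by simp
  next
    case False
    then obtain p where p: "Factorial_Ring.prime p" "p dvd N" using prime_factor_nat by blast
    then obtain m where m: "N = p * m" by blast
    have m0: "m > 0" "m < N" using m less.prems(1) prime_gt_1_nat[OF p(1)] by auto
    define K where "K = {v \<in> carrier G. \<theta> v [^]\<^bsub>A\<^esub> m = \<one>\<^bsub>A\<^esub>}"
    have "K = carrier G"
    proof (rule no_finite_index_prime[OF nofi _ _ p(1)])
      show "subgroup K G"
      proof (rule subgroupI)
        have "\<one> \<in> K" by (simp add: K_def)
        thus "K \<noteq> {}" by blast
        show "a \<otimes> b \<in> K" if "a \<in> K" "b \<in> K" for a b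
          using that comm[of a b] by (simp add: K_def \<theta>.H.pow_mult_distrib)
        show "inv a \<in> K" if "a \<in> K" for a
          using that by (simp add: K_def \<theta>.H.nat_pow_inv)
      qed (auto simp: K_def)
      show "comm_elt G u v \<in> K" if "u \<in> carrier G" "v \<in> carrier G" for u v
      proof -
        have "\<theta> (comm_elt G u v) = \<one>\<^bsub>A\<^esub>"
          using that comm[OF that] by (simp add: \<theta>.hom_comm_elt \<theta>.H.comm_elt_eq_one_iff)
        thus ?thesis using that by (simp add: K_def)
      qed
      show "v [^] p \<in> K" if "v \<in> carrier G" for v
        using that less.prems(2)[OF that] by (simp add: K_def \<theta>.hom_nat_pow \<theta>.H.nat_pow_pow m)
    qed
    hence "\<theta> u [^]\<^bsub>A\<^esub> m = \<one>\<^bsub>A\<^esub>" if "u \<in> carrier G" for u using that by (auto simp: K_def)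
    thus ?thesis using less.IH[OF m0(2,1)] less.prems(3) by blast
  qed
qed

text \<open>For \<open>x\<close> in the second centre with \<open>x [^] N = \<one>\<close>, also
  \<open>[x, g]^N = [x^N, g] = \<one>\<close>. So \<open>g \<mapsto> [x, g]\<close> has a central
  image of finite exponent and is trivial.\<close>

lemma no_finite_index_abelian:
  assumes nofi: "\<And>M. \<lbrakk>subgroup M G; finite_cover G (carrier G) M\<rbrakk> \<Longrightarrow> M = carrier G"
    and "hypercentral G" "\<And>x. x \<in> carrier G \<Longrightarrow> \<exists>N>0. x [^] (N::nat) = \<one>"
  shows "centre G = carrier G"
  using assms(2)
proof (rule centre_induct)
  fix x assume x: "x \<in> carrier G" and c: "\<And>g. g \<in> carrier G \<Longrightarrow> comm_elt G x g \<in> centre G"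
  obtain N :: nat where N: "N > 0" "x [^] N = \<one>" using assms(3)[OF x] by blast
  have "comm_elt G x g = \<one>" if g: "g \<in> carrier G" for g
  proof (rule no_finite_index_hom_trivial[OF nofi, where A = G and \<theta> = "\<lambda>g. comm_elt G x g" and N = N])
    show "group_hom G G (\<lambda>g. comm_elt G x g)"
      using comm_elt_hom_right[OF x c] by unfold_locales
    show "comm_elt G x u \<otimes> comm_elt G x v = comm_elt G x v \<otimes> comm_elt G x u"
      if "u \<in> carrier G" "v \<in> carrier G" for u v
      using that x c by (intro centreD) auto
    show "comm_elt G x v [^] N = \<one>" if "v \<in> carrier G" for v
      using comm_elt_pow_left[OF x that c[OF that], of N] that N by simp
  qed (use N g in auto)
  thus "x \<in> centre G" using x by (intro centreI) (auto simp: comm_elt_eq_one_iff)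
qed

text \<open>For a prime \<open>p\<close> the \<open>p\<close>-th powers form a subgroup to which
  \<open>no_finite_index_prime\<close> applies, so every element is a \<open>p\<close>-th power. A
  general \<open>n\<close> is reached by splitting off primes.\<close>

lemma no_finite_index_divisible:
  assumes nofi: "\<And>M. \<lbrakk>subgroup M G; finite_cover G (carrier G) M\<rbrakk> \<Longrightarrow> M = carrier G"
    and centre: "centre G = carrier G"
  shows "divisible_subset G (carrier G)"
proof -
  have comm: "x \<otimes> y = y \<otimes> x" if "x \<in> carrier G" "y \<in> carrier G" for x y
    using that centre centreD by blast
  have prime: "\<exists>y\<in>carrier G. y [^] p = x" if p: "Factorial_Ring.prime p" and x: "x \<in> carrier G" for p :: nat and x
  proof -
    have "(\<lambda>y. y [^] p) ` carrier G = carrier G"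
    proof (rule no_finite_index_prime[OF nofi _ _ p])
      show "subgroup ((\<lambda>y. y [^] p) ` carrier G) G"
      proof (rule subgroupI)
        show "a \<otimes> b \<in> (\<lambda>y. y [^] p) ` carrier G"
          if ab: "a \<in> (\<lambda>y. y [^] p) ` carrier G" "b \<in> (\<lambda>y. y [^] p) ` carrier G" for a b
        proof -
          obtain u w where "a = u [^] p" "b = w [^] p" "u \<in> carrier G" "w \<in> carrier G"
            using ab by blast
          hence "a \<otimes> b = (u \<otimes> w) [^] p" "u \<otimes> w \<in> carrier G"
            using pow_mult_distrib[OF comm[of u w]] by simp_all
          thus ?thesis by blast
        qed
        show "inv a \<in> (\<lambda>y. y [^] p) ` carrier G" if "a \<in> (\<lambda>y. y [^] p) ` carrier G" for a
          using that by (auto simp: nat_pow_inv[symmetric])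
      qed auto
      show "comm_elt G u v \<in> (\<lambda>y. y [^] p) ` carrier G" if "u \<in> carrier G" "v \<in> carrier G" for u v
      proof -
        have "comm_elt G u v = \<one> [^] p" using that comm[OF that] by (simp add: comm_elt_eq_one_iff)
        thus ?thesis by blast
      qed
    qed auto
    thus ?thesis using x by (metis imageE)
  qed
  have "\<exists>y\<in>carrier G. y [^] n = x" if "n > 0" "x \<in> carrier G" for n :: nat and x
    using that
  proof (induction n arbitrary: x rule: less_induct)
    case (less n)
    show ?case
    proof (cases "n = 1")
      case True thus ?thesis using less.prems by (intro bexI[of _ x]) auto
    next
      case False
      then obtain p where p: "Factorial_Ring.prime p" "p dvd n" using prime_factor_nat by blast
      then obtain m where m: "n = m * p" by (auto simp: dvd_def mult.commute)
      have m0: "m > 0" "m < n" using m less.prems(1) prime_gt_1_nat[OF p(1)] by auto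
      obtain y where y: "y \<in> carrier G" "y [^] p = x" using prime[OF p(1) less.prems(2)] by blast
      obtain z where z: "z \<in> carrier G" "z [^] m = y" using less.IH[OF m0(2,1) y(1)] by blast
      have "z [^] n = x" using nat_pow_pow[OF z(1), of m p] y z m by simp
      thus ?thesis using z by blast
    qed
  qed
  thus ?thesis by (simp add: divisible_subset_def)
qed

lemma no_finite_index_abelian_divisible:
  assumes "hypercentral G" "subgroup V G"
    and nofi: "\<And>M. \<lbrakk>subgroup M G; M \<subseteq> V; finite_cover G V M\<rbrakk> \<Longrightarrow> M = V"
    and tors: "\<And>x. x \<in> V \<Longrightarrow> \<exists>N>0. x [^] (N::nat) = \<one>"
  shows "abelian_subset G V" "divisible_subset G V"
proof -
  interpret V: subgroup V G by fact
  interpret GV: group "G\<lparr>carrier := V\<rparr>" by (rule subgroup_imp_group[OF assms(2)])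
  have nofi': "M = carrier (G\<lparr>carrier := V\<rparr>)"
    if M: "subgroup M (G\<lparr>carrier := V\<rparr>)"
      and cov: "finite_cover (G\<lparr>carrier := V\<rparr>) (carrier (G\<lparr>carrier := V\<rparr>)) M" for M
  proof -
    have "subgroup M G" "M \<subseteq> V" using incl_subgroup[OF assms(2) M] subgroup.subset[OF M] by auto
    moreover have "finite_cover G V M"
      using cov V.subset unfolding finite_cover_def by (auto simp: set_mult_def)
    ultimately show ?thesis using nofi by simp
  qed
  have c: "centre (G\<lparr>carrier := V\<rparr>) = carrier (G\<lparr>carrier := V\<rparr>)"
  proof (rule GV.no_finite_index_abelian[OF nofi' hypercentral_subgroup[OF assms(1,2)]])
    show "\<exists>N>0. x [^]\<^bsub>G\<lparr>carrier := V\<rparr>\<^esub> (N::nat) = \<one>\<^bsub>G\<lparr>carrier := V\<rparr>\<^esub>"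
      if "x \<in> carrier (G\<lparr>carrier := V\<rparr>)" for x
      using tors that by (simp add: nat_pow_consistent[symmetric])
  qed
  show "abelian_subset G V"
    using c GV.centreD by (auto simp: abelian_subset_def)
  show "divisible_subset G V"
    using GV.no_finite_index_divisible[OF nofi' c]
    by (simp add: divisible_subset_def nat_pow_consistent[symmetric])
qed

end

section \<open>Torsion abelian groups\<close>

context comm_group
begin

lemma generate_insert_subset:
  assumes "Y \<subseteq> carrier G" "y \<in> carrier G"
  shows "generate G (insert y Y) \<subseteq> generate G Y <#> generate G {y}"
proof (rule generate_subgroup_incl)
  have Y: "subgroup (generate G Y) G" and y: "subgroup (generate G {y}) G"
    using assms by (auto intro: generate_is_subgroup)
  show "subgroup (generate G Y <#> generate G {y}) G" by (rule mult_subgroups[OF Y y])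
  show "insert y Y \<subseteq> generate G Y <#> generate G {y}"
    using subset_set_mult[OF Y y] generate.incl[of _ Y G] generate.incl[of y "{y}" G] by blast
qed

text \<open>For \<open>E = generate G Y\<close> the quotient \<open>E/E^n\<close> is generated by
  \<open>card Y\<close> elements of order dividing \<open>n\<close>, and \<open>R\<close> represents
  its elements. A new generator \<open>y\<close> contributes its powers with exponents below
  \<open>n\<close>.\<close>

lemma generate_mod_powers:
  assumes "finite Y" "Y \<subseteq> carrier G" "n > (0::nat)"
  shows "\<exists>R. finite R \<and> R \<subseteq> carrier G \<and> card R \<le> n ^ card Y \<and>
           generate G Y \<subseteq> (\<lambda>x. x [^] n) ` generate G Y <#> R"
  using assms(1,2)
proof (induction Y rule: finite_induct)
  case empty
  have "generate G {} \<subseteq> (\<lambda>x. x [^] n) ` generate G {} <#> {\<one>}"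
    by (auto simp: generate_empty set_mult_def)
  thus ?case by (intro exI[of _ "{\<one>}"]) auto
next
  case (insert y Y)
  hence y: "y \<in> carrier G" and Y: "Y \<subseteq> carrier G" by auto
  obtain R where R: "finite R" "R \<subseteq> carrier G" "card R \<le> n ^ card Y"
    "generate G Y \<subseteq> (\<lambda>x. x [^] n) ` generate G Y <#> R"
    using insert.IH[OF Y] by blast
  let ?P = "(\<lambda>r. y [^] r) ` {..<n}"
  have P: "finite ?P" "?P \<subseteq> carrier G" "card ?P \<le> n"
    using y card_image_le[of "{..<n}" "\<lambda>r. y [^] r"] by auto
  have im: "R <#> ?P = (\<lambda>(a, b). a \<otimes> b) ` (R \<times> ?P)" by (auto simp: set_mult_def)
  have "card (R <#> ?P) \<le> card (R \<times> ?P)" unfolding im using R P by (intro card_image_le) simp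
  also have "\<dots> \<le> n ^ card Y * n" unfolding card_cartesian_product using R P by (intro mult_mono) auto
  finally have card: "card (R <#> ?P) \<le> n ^ card (insert y Y)"
    using insert.hyps by (simp add: mult.commute)
  have sub: "generate G (insert y Y) \<subseteq> (\<lambda>x. x [^] n) ` generate G (insert y Y) <#> (R <#> ?P)"
  proof
    fix x assume "x \<in> generate G (insert y Y)"
    hence "x \<in> generate G Y <#> generate G {y}" using generate_insert_subset[OF Y y] by blast
    then obtain a i where a: "a \<in> generate G Y" and x: "x = a \<otimes> y [^] (i::int)"
      unfolding set_mult_def generate_pow[OF y] by blast
    obtain b \<rho> where b: "b \<in> generate G Y" "\<rho> \<in> R" "a = b [^] n \<otimes> \<rho>"
      using R(4) a unfolding set_mult_def by blast
    have bc: "b \<in> carrier G" and rc: "\<rho> \<in> carrier G"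
      using generate_in_carrier[OF Y b(1)] b(2) R(2) by auto
    define r where "r = nat (i mod int n)"
    have r: "r < n" "i = (i div int n) * int n + int r"
      using assms(3) by (simp_all add: r_def nat_less_iff)
    define z where "z = y [^] (i div int n)"
    have zc: "z \<in> carrier G" using y by (simp add: z_def)
    have "z [^] n = y [^] ((i div int n) * int n)"
      using y by (simp add: z_def int_pow_pow flip: int_pow_int)
    hence yi: "y [^] i = z [^] n \<otimes> y [^] r"
      using y by (subst r(2)) (simp add: int_pow_mult int_pow_int)
    have "x = (b \<otimes> z) [^] n \<otimes> (\<rho> \<otimes> y [^] r)"
      unfolding x b(3) yi using bc rc zc y by (simp add: nat_pow_distrib m_ac)
    moreover have "b \<otimes> z \<in> generate G (insert y Y)"
    proof (rule generate.eng)
      show "b \<in> generate G (insert y Y)" using b(1) mono_generate[of Y "insert y Y"] by blast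
      have "z \<in> generate G {y}" unfolding generate_pow[OF y] z_def by blast
      thus "z \<in> generate G (insert y Y)" using mono_generate[of "{y}" "insert y Y"] by blast
    qed
    moreover have "\<rho> \<otimes> y [^] r \<in> R <#> ?P" using b(2) r(1) unfolding set_mult_def by blast
    ultimately show "x \<in> (\<lambda>x. x [^] n) ` generate G (insert y Y) <#> (R <#> ?P)"
      unfolding set_mult_def by blast
  qed
  show ?case
    by (rule exI[of _ "R <#> ?P"])
      (intro conjI finite_set_mult[OF R(1) P(1)] setmult_subset_G[OF R(2) P(2)] card sub)
qed

lemma exponent_subgroup: "subgroup {x \<in> carrier G. x [^] (m::nat) = \<one>} G"
proof (rule subgroupI)
  have "\<one> \<in> {x \<in> carrier G. x [^] m = \<one>}" by simp
  thus "{x \<in> carrier G. x [^] m = \<one>} \<noteq> {}" by blast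
qed (auto simp: nat_pow_inv nat_pow_distrib)

lemma finite_power_torsion_uniform:
  assumes "finite Y" "Y \<subseteq> carrier G" "\<And>y. y \<in> Y \<Longrightarrow> power_torsion G n y"
  shows "\<exists>k. \<forall>y\<in>Y. y [^] (n ^ k) = \<one>"
proof -
  obtain k where k: "\<And>y. y \<in> Y \<Longrightarrow> y [^] (n ^ k y) = \<one>"
    using assms(3) unfolding power_torsion_def by metis
  obtain l where l: "\<And>y. y \<in> Y \<Longrightarrow> k y \<le> l"
    using assms(1) by (metis Max_ge finite_imageI image_eqI)
  have "\<forall>y\<in>Y. y [^] (n ^ l) = \<one>"
    using pow_power_mono[OF k _ l] assms(2) by blast
  thus ?thesis ..
qed

text \<open>Some \<open>n ^ k\<close> kills all generators and thus the whole group, so the finitely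
  many representatives modulo \<open>n ^ k\<close>-th powers already exhaust it.\<close>

lemma finite_generate_torsion:
  assumes "finite Y" "Y \<subseteq> carrier G" "n > 0" "\<And>y. y \<in> Y \<Longrightarrow> power_torsion G n y"
  shows "finite (generate G Y)"
proof -
  obtain k where k: "\<forall>y\<in>Y. y [^] (n ^ k) = \<one>"
    using finite_power_torsion_uniform[OF assms(1,2,4)] by blast
  hence "generate G Y \<subseteq> {x \<in> carrier G. x [^] (n ^ k) = \<one>}"
    using assms(2) by (intro generate_subgroup_incl exponent_subgroup) auto
  hence *: "(\<lambda>x. x [^] (n ^ k)) ` generate G Y \<subseteq> {\<one>}" by blast
  obtain R where R: "finite R" "R \<subseteq> carrier G"
    "generate G Y \<subseteq> (\<lambda>x. x [^] (n ^ k)) ` generate G Y <#> R"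
    using generate_mod_powers[OF assms(1,2), of "n ^ k"] assms(3) by auto
  have "generate G Y \<subseteq> {\<one>} <#> R" using R(3) mono_set_mult[OF * order_refl, of G R] by blast
  thus ?thesis using finite_set_mult[OF _ R(1), of "{\<one>}"] finite_subset by blast
qed

text \<open>In a finite abelian group the kernel and the cokernel of the \<open>n\<close>-th power
  map have the same size. The bound depends on the number of generators but not on their orders,
  which makes it uniform along a tower of roots.\<close>

lemma card_exponent_le:
  assumes "finite Y" "Y \<subseteq> carrier G" "n > 0" "\<And>y. y \<in> Y \<Longrightarrow> power_torsion G n y"
  shows "card {x \<in> generate G Y. x [^] n = \<one>} \<le> n ^ card Y"
proof -
  define E where "E = generate G Y"
  let ?f = "\<lambda>x. x [^] n" and ?T = "{x \<in> E. x [^] n = \<one>}"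
  have fin: "finite E" unfolding E_def by (rule finite_generate_torsion[OF assms])
  interpret E: subgroup E G unfolding E_def by (rule generate_is_subgroup[OF assms(2)])
  obtain R where R: "finite R" "R \<subseteq> carrier G" "card R \<le> n ^ card Y" "E \<subseteq> ?f ` E <#> R"
    using generate_mod_powers[OF assms(1-3)] unfolding E_def by blast
  have fibre: "card {x \<in> E. ?f x = z} = card ?T" if z: "z \<in> ?f ` E" for z
  proof -
    obtain x0 where x0: "x0 \<in> E" "z = x0 [^] n" using z by blast
    have "{x \<in> E. ?f x = z} = (\<lambda>t. t \<otimes> x0) ` ?T"
    proof (intro equalityI subsetI)
      fix x assume x: "x \<in> {x \<in> E. ?f x = z}"
      hence "x \<otimes> inv x0 \<in> ?T" using x0 by (simp add: nat_pow_distrib nat_pow_inv)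
      moreover have "x = x \<otimes> inv x0 \<otimes> x0" using x x0 by (simp add: m_assoc)
      ultimately show "x \<in> (\<lambda>t. t \<otimes> x0) ` ?T" by blast
    next
      fix x assume "x \<in> (\<lambda>t. t \<otimes> x0) ` ?T"
      thus "x \<in> {x \<in> E. ?f x = z}" using x0 by (auto simp: nat_pow_distrib)
    qed
    moreover have "inj_on (\<lambda>t. t \<otimes> x0) ?T" using x0 by (intro inj_onI) simp
    ultimately show ?thesis by (simp add: card_image)
  qed
  have "card E = (\<Sum>z\<in>?f ` E. card {x \<in> E. ?f x = z})"
    using sum.image_gen[OF fin, of "\<lambda>_. 1::nat" ?f] by simp
  also have "\<dots> = card (?f ` E) * card ?T" using fibre by simp
  finally have 1: "card E = card (?f ` E) * card ?T" .
  have im: "?f ` E <#> R = (\<lambda>(a, b). a \<otimes> b) ` (?f ` E \<times> R)" by (auto simp: set_mult_def)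
  have "card E \<le> card (?f ` E <#> R)"
    using R fin by (intro card_mono finite_set_mult) auto
  also have "\<dots> \<le> card (?f ` E \<times> R)" unfolding im using fin R by (intro card_image_le) simp
  finally have "card (?f ` E) * card ?T \<le> card (?f ` E) * card R"
    using 1 by (simp add: card_cartesian_product)
  moreover have "card (?f ` E) > 0" using fin subgroup.one_closed[OF E.subgroup_axioms] by (metis card_gt_0_iff empty_iff finite_imageI image_is_empty)
  ultimately show ?thesis using R(3) unfolding E_def by simp
qed

text \<open>\<open>q\<close> is the projection onto a direct complement of \<open>S\<close>.\<close>
lemma divisible_projection:
  assumes "subgroup S G" "n > 0"
    and tors: "\<And>x. x \<in> carrier G \<Longrightarrow> power_torsion G n x"
    and div: "\<And>s. s \<in> S \<Longrightarrow> \<exists>t\<in>S. t [^] n = s"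
  obtains q where "q \<in> hom G G" "\<And>s. s \<in> S \<Longrightarrow> q s = \<one>"
    "\<And>x. x \<in> carrier G \<Longrightarrow> \<exists>s\<in>S. q x = s \<otimes> x"
proof -
  interpret S: subgroup S G by fact
  \<comment> \<open>The complement is a subgroup \<open>K\<close> maximal among those meeting
    \<open>S\<close> trivially; it remains to see that \<open>S <#> K\<close> is everything.\<close>
  define \<A> where "\<A> = {K. subgroup K G \<and> K \<inter> S \<subseteq> {\<one>}}"
  have "\<exists>M\<in>\<A>. \<forall>N\<in>\<A>. M \<subseteq> N \<longrightarrow> N = M"
  proof (rule subset_Zorn_nonempty)
    show "\<A> \<noteq> {}" using triv_subgroup unfolding \<A>_def by blast
    fix c assume c: "c \<noteq> {}" "subset.chain \<A> c"
    have "subgroup (\<Union>c) G"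
    proof (rule Union_chain_subgroup[OF c(1)])
      show "A \<subseteq> B \<or> B \<subseteq> A" if "A \<in> c" "B \<in> c" for A B
        using c that unfolding subset.chain_def by blast
      show "subgroup A G" if "A \<in> c" for A
        using c that unfolding subset.chain_def \<A>_def by blast
    qed
    moreover have "\<Union>c \<inter> S \<subseteq> {\<one>}" using c unfolding subset.chain_def \<A>_def by blast
    ultimately show "\<Union>c \<in> \<A>" by (simp add: \<A>_def)
  qed
  then obtain K where "K \<in> \<A>" and max_\<A>: "\<And>N. N \<in> \<A> \<Longrightarrow> K \<subseteq> N \<Longrightarrow> N = K" by blast
  hence K: "subgroup K G" "K \<inter> S \<subseteq> {\<one>}" by (simp_all add: \<A>_def)
  have max: "N = K" if "subgroup N G" "N \<inter> S \<subseteq> {\<one>}" "K \<subseteq> N" for N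
    using max_\<A>[of N] that by (simp add: \<A>_def)
  interpret K: subgroup K G by fact
  define T where "T = S <#> K"
  interpret T: subgroup T G unfolding T_def by (rule mult_subgroups[OF assms(1) K(1)])
  have ST: "S \<subseteq> T" "K \<subseteq> T" unfolding T_def by (rule subset_set_mult[OF assms(1) K(1)])+
  have T_pow: "y [^] (i::int) \<in> T" if "y \<in> T" for y i
    by (rule subgroup_int_pow_closed[OF T.subgroup_axioms that])
  have step: "e \<in> T" if e: "e \<in> carrier G" and en: "e [^] n \<in> T" for e
  proof -
    \<comment> \<open>\<open>m\<close> is the order of \<open>e\<close> modulo \<open>T\<close>; it
      divides \<open>n\<close>, as \<open>e [^] n\<close> lies in \<open>T\<close>.\<close>
    define m where "m = (LEAST m::nat. m > 0 \<and> e [^] m \<in> T)"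
    have "\<exists>m::nat. m > 0 \<and> e [^] m \<in> T" using en assms(2) by blast
    hence m: "m > 0" "e [^] m \<in> T" unfolding m_def by (metis (mono_tags, lifting) LeastI)+
    have least: "m \<le> i" if "i > 0" "e [^] i \<in> T" for i
      unfolding m_def using that by (intro Least_le) simp
    have dvd: "int m dvd i" if i: "e [^] (i::int) \<in> T" for i
    proof -
      define r where "r = nat (i mod int m)"
      have r: "r < m" "int r = i - int m * (i div int m)"
        using m(1) by (simp_all add: r_def nat_less_iff minus_mult_div_eq_mod)
      have "e [^] r = e [^] (i + int m * - (i div int m))" using r(2) by (simp flip: int_pow_int)
      also have "\<dots> = e [^] i \<otimes> (e [^] int m) [^] (- (i div int m))"
        using e by (simp only: int_pow_mult int_pow_pow)
      also have "\<dots> \<in> T"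
      proof -
        have "e [^] int m \<in> T" using m(2) by (simp add: int_pow_int)
        thus ?thesis by (rule T.m_closed[OF i T_pow])
      qed
      finally have "r = 0" using least[of r] r(1) by auto
      hence "i = int m * (i div int m)" using r(2) by simp
      thus ?thesis by (rule dvdI)
    qed
    have "int m dvd int n" using dvd[of "int n"] en by (simp add: int_pow_int)
    then obtain c where c: "n = m * c" by (meson dvdE int_dvd_int_iff)
    obtain s k where sk: "s \<in> S" "k \<in> K" "e [^] m = s \<otimes> k"
      using m(2) unfolding T_def set_mult_def by blast
    obtain u where u: "u \<in> S" "u [^] n = s" using div[OF sk(1)] by blast
    \<comment> \<open>An \<open>m\<close>-th root of \<open>s\<close> inside \<open>S\<close>,
      obtained from an \<open>n\<close>-th root because \<open>n = m * c\<close>. Dividing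
      \<open>e\<close> by it leaves an \<open>f\<close> with \<open>f [^] m\<close> in
      \<open>K\<close>.\<close>
    define t where "t = u [^] c"
    have t: "t \<in> S" "t [^] m = s"
      unfolding t_def using u subgroup_nat_pow_closed[OF assms(1)] c
      by (auto simp: nat_pow_pow mult.commute)
    define f where "f = e \<otimes> inv t"
    have fc: "f \<in> carrier G" using e t by (simp add: f_def)
    have fm: "f [^] m = k"
    proof -
      have "f [^] m = e [^] m \<otimes> inv (t [^] m)" using e t(1) by (simp add: f_def nat_pow_distrib nat_pow_inv)
      also have "\<dots> = k \<otimes> s \<otimes> inv s"
        unfolding t(2) sk(3) by (simp only: m_comm[OF S.mem_carrier[OF sk(1)] K.mem_carrier[OF sk(2)]])
      also have "\<dots> = k" using sk by (simp add: m_assoc)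
      finally show ?thesis .
    qed
    have gf: "subgroup (generate G {f}) G" using fc by (intro generate_is_subgroup) auto
    \<comment> \<open>If \<open>f [^] i\<close> lies in \<open>T\<close>, then so does
      \<open>e [^] i\<close>, hence \<open>m\<close> divides \<open>i\<close> and
      \<open>f [^] i\<close> is a power of \<open>k\<close>. So adjoining \<open>f\<close> to
      \<open>K\<close> keeps the intersection with \<open>S\<close> trivial, and maximality puts
      \<open>f\<close> into \<open>K\<close>.\<close>
    have "K <#> generate G {f} = K"
    proof (rule max[OF mult_subgroups[OF K(1) gf] _ subset_set_mult(1)[OF K(1) gf]])
      show "(K <#> generate G {f}) \<inter> S \<subseteq> {\<one>}"
      proof
        fix y assume y: "y \<in> (K <#> generate G {f}) \<inter> S"
        then obtain k' i where ki: "k' \<in> K" "y = k' \<otimes> f [^] (i::int)"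
          unfolding set_mult_def generate_pow[OF fc] by blast
        have "f [^] i = inv k' \<otimes> y" using ki fc by (simp add: l_inv_cancel)
        moreover have "inv k' \<in> T" "y \<in> T" using ki y ST by auto
        ultimately have fiT: "f [^] i \<in> T" by simp
        have "e = f \<otimes> t" using e t by (simp add: f_def m_assoc)
        hence "e [^] i = f [^] i \<otimes> t [^] i" using fc t by (simp add: int_pow_distrib)
        moreover have "t [^] i \<in> T" by (rule T_pow[OF subsetD[OF ST(1) t(1)]])
        ultimately have "e [^] i \<in> T" using fiT by simp
        then obtain j where "i = int m * j" using dvd by blast
        hence "f [^] i = k [^] j" using fc fm by (simp add: int_pow_int flip: int_pow_pow)
        hence "f [^] i \<in> K" using subgroup_int_pow_closed[OF K(1) sk(2)] by simp
        hence "y \<in> K" using ki by simp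
        thus "y \<in> {\<one>}" using y K(2) by blast
      qed
    qed
    moreover have "f \<in> K <#> generate G {f}"
      using subset_set_mult(2)[OF K(1) gf] generate.incl[of f "{f}" G] by blast
    ultimately have "f \<in> T" using ST by blast
    moreover have "e = f \<otimes> t" using e t by (simp add: f_def m_assoc)
    ultimately show ?thesis using t ST by (metis T.m_closed subsetD)
  qed
  have all: "x \<in> T" if x: "x \<in> carrier G" for x
  proof -
    obtain k where "x [^] (n ^ k) = \<one>" using tors[OF x] by (auto simp: power_torsion_def)
    hence "x [^] (n ^ k) \<in> T" by simp
    thus "x \<in> T"
    proof (induction k)
      case (Suc k)
      have "(x [^] (n ^ k)) [^] n \<in> T" using Suc.prems x by (simp add: nat_pow_pow mult.commute)
      hence "x [^] (n ^ k) \<in> T" by (rule step[OF nat_pow_closed[OF x]])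
      thus ?case by (rule Suc.IH)
    qed (use x in simp)
  qed
  \<comment> \<open>An element of \<open>K\<close> is determined by its coset of \<open>S\<close>;
    this makes \<open>q\<close> multiplicative.\<close>
  have uniq: "k = k'" if "k \<in> K" "k' \<in> K" "k = s \<otimes> x" "k' = s' \<otimes> x" "s \<in> S" "s' \<in> S" "x \<in> carrier G"
    for k k' s s' x
  proof -
    have "k \<otimes> inv k' = s \<otimes> inv s'" using that by (simp add: word_simps r_inv_cancel)
    moreover have "k \<otimes> inv k' \<in> K" "s \<otimes> inv s' \<in> S" using that by auto
    ultimately have "k \<otimes> inv k' = \<one>" using K(2) by auto
    thus ?thesis using that(1,2) by (metis K.mem_carrier inv_closed inv_equality inv_inv)
  qed
  have "\<exists>k\<in>K. \<exists>s\<in>S. k = s \<otimes> x" if x: "x \<in> carrier G" for x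
  proof -
    obtain s k where sk: "s \<in> S" "k \<in> K" "x = s \<otimes> k"
      using all[OF x] unfolding T_def set_mult_def by blast
    hence "k = inv s \<otimes> x" by (simp add: l_inv_cancel)
    thus ?thesis using sk by blast
  qed
  then obtain q where q: "\<And>x. x \<in> carrier G \<Longrightarrow> q x \<in> K \<and> (\<exists>s\<in>S. q x = s \<otimes> x)" by metis
  show ?thesis
  proof (rule that[of q])
    show "q \<in> hom G G"
    proof (rule homI)
      fix x y assume x: "x \<in> carrier G" and y: "y \<in> carrier G"
      obtain s s' where s: "s \<in> S" "q x = s \<otimes> x" "s' \<in> S" "q y = s' \<otimes> y" using q x y by meson
      obtain s'' where s'': "s'' \<in> S" "q (x \<otimes> y) = s'' \<otimes> (x \<otimes> y)" using q[of "x \<otimes> y"] x y by auto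
      show "q (x \<otimes> y) = q x \<otimes> q y"
      proof (rule uniq)
        show "q x \<otimes> q y = (s \<otimes> s') \<otimes> (x \<otimes> y)" using s x y by (simp add: m_ac)
        show "q (x \<otimes> y) = s'' \<otimes> (x \<otimes> y)" by fact
        show "q (x \<otimes> y) \<in> K" using q x y by blast
        show "q x \<otimes> q y \<in> K" using q x y by blast
      qed (use x y s s'' in auto)
    qed (use q K.mem_carrier in blast)
    show "q s = \<one>" if s: "s \<in> S" for s
    proof -
      obtain s' where "s' \<in> S" "q s = s' \<otimes> s" using q[of s] s by auto
      hence "q s \<in> K \<inter> S" using s q[of s] by auto
      thus ?thesis using K(2) by blast
    qed
  qed (use q in blast)
qed

end

section \<open>Divisible modules for a finite group\<close>

text \<open>Divisibility by \<open>n\<close> alone: in an abelian group of elements of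
  \<open>n\<close>-power order it already implies divisibility by every positive integer.\<close>

definition power_divisible :: "('a, 'b) monoid_scheme \<Rightarrow> nat \<Rightarrow> 'a set \<Rightarrow> bool" where
  "power_divisible G n A \<longleftrightarrow> (\<forall>x\<in>A. \<exists>y\<in>A. y [^]\<^bsub>G\<^esub> n = x)"

locale abelian_by_finite = group G for G (structure) +
  fixes V H :: "'a set"
  assumes V_normal: "V \<lhd> G"
    and V_comm: "\<And>x y. x \<in> V \<Longrightarrow> y \<in> V \<Longrightarrow> x \<otimes> y = y \<otimes> x"
    and H_subgroup: "subgroup H G"
    and H_finite: "finite H"
    and VH: "V <#> H = carrier G"
begin

sublocale V: normal V G by (rule V_normal)

sublocale H: subgroup H G by (rule H_subgroup)

abbreviation "VG \<equiv> G\<lparr>carrier := V\<rparr>"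

abbreviation "n \<equiv> card H"

sublocale VG: comm_group VG
proof -
  interpret VG: group VG by (rule subgroup_imp_group[OF V.subgroup_axioms])
  show "comm_group VG" by (rule VG.group_comm_groupI) (simp add: V_comm)
qed

lemma n_pos: "n > 0"
  using H_finite H.one_closed card_gt_0_iff by blast

lemma decompose:
  assumes "g \<in> carrier G"
  obtains v h where "v \<in> V" "h \<in> H" "g = v \<otimes> h"
  using assms unfolding VH[symmetric] set_mult_def by blast

lemma V_pow_mult: "\<lbrakk>x \<in> V; y \<in> V\<rbrakk> \<Longrightarrow> (x \<otimes> y) [^] (m::nat) = x [^] m \<otimes> y [^] m"
  by (simp add: pow_mult_distrib V_comm)

lemma V_conj: "\<lbrakk>x \<in> V; v \<in> V\<rbrakk> \<Longrightarrow> v \<otimes> x \<otimes> inv v = x"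
  using V_comm[of v x] by (simp add: m_assoc)

text \<open>\<open>V\<close> is abelian and acts trivially on itself, so \<open>G\<close> acts on
  \<open>V\<close> through \<open>H\<close>. Hence invariance under \<open>H\<close> is enough for
  normality of subgroups of \<open>V\<close>.\<close>

lemma conj_decompose:
  assumes "x \<in> V" "v \<in> V" "h \<in> H"
  shows "(v \<otimes> h) \<otimes> x \<otimes> inv (v \<otimes> h) = h \<otimes> x \<otimes> inv h"
proof -
  have "(v \<otimes> h) \<otimes> x \<otimes> inv (v \<otimes> h) = v \<otimes> (h \<otimes> x \<otimes> inv h) \<otimes> inv v"
    using assms by (simp add: word_simps)
  also have "\<dots> = h \<otimes> x \<otimes> inv h"
    using assms by (intro V_conj V.inv_op_closed2) auto
  finally show ?thesis .
qed

lemma normal_generate: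
  assumes "Y \<subseteq> V" "\<And>y h. y \<in> Y \<Longrightarrow> h \<in> H \<Longrightarrow> h \<otimes> y \<otimes> inv h \<in> Y"
  shows "generate G Y \<lhd> G"
proof (rule normal_generateI)
  show "Y \<subseteq> carrier G" using assms(1) V.subset by blast
  fix y g assume y: "y \<in> Y" and g: "g \<in> carrier G"
  obtain v h where vh: "v \<in> V" "h \<in> H" "g = v \<otimes> h" using decompose[OF g] .
  thus "g \<otimes> y \<otimes> inv g \<in> Y" using conj_decompose[of y v h] assms y by auto
qed

lemma comm_subgroup_normal:
  assumes "D \<lhd> G" "D \<subseteq> V"
  shows "comm_subgroup G D H \<lhd> G" "comm_subgroup G D H \<subseteq> D"
proof -
  interpret D: normal D G by fact
  let ?Y = "{comm_elt G a b | a b. a \<in> D \<and> b \<in> H}"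
  have YD: "?Y \<subseteq> D" using comm_elt_mem_left[OF assms(1)] by auto
  show "comm_subgroup G D H \<subseteq> D"
    unfolding comm_subgroup_def by (rule generate_subgroup_incl[OF YD D.subgroup_axioms])
  show "comm_subgroup G D H \<lhd> G"
    unfolding comm_subgroup_def
  proof (rule normal_generate)
    show "?Y \<subseteq> V" using YD assms(2) by blast
    fix y h assume "y \<in> ?Y" and h: "h \<in> H"
    then obtain a b where ab: "a \<in> D" "b \<in> H" "y = comm_elt G a b" by blast
    have "h \<otimes> y \<otimes> inv h = comm_elt G (h \<otimes> a \<otimes> inv h) (h \<otimes> b \<otimes> inv h)"
      using ab h by (simp add: comm_elt_conj)
    moreover have "h \<otimes> a \<otimes> inv h \<in> D" using ab h by (simp add: D.inv_op_closed2)
    moreover have "h \<otimes> b \<otimes> inv h \<in> H" using ab h by simp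
    ultimately show "h \<otimes> y \<otimes> inv h \<in> ?Y" by blast
  qed
qed

lemma comm_subgroup_eq:
  assumes "contranormal G H"
    and nofi: "\<And>M. \<lbrakk>subgroup M G; M \<subseteq> V; finite_cover G V M\<rbrakk> \<Longrightarrow> M = V"
  shows "comm_subgroup G V H = V"
proof -
  define W where "W = comm_subgroup G V H"
  have W: "W \<lhd> G" "W \<subseteq> V" unfolding W_def by (rule comm_subgroup_normal[OF V_normal order_refl])+
  have Wsub: "subgroup W G" by (rule normal_imp_subgroup[OF W(1)])
  have "normal_closure G H \<subseteq> W <#> H"
    unfolding normal_closure_def
  proof (rule generate_subgroup_incl[OF _ mult_norm_subgroup[OF W(1) H_subgroup]], rule subsetI)
    fix y assume "y \<in> (\<Union>g\<in>carrier G. (\<lambda>h. g \<otimes> h \<otimes> inv g) ` H)"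
    then obtain g h where gh: "g \<in> carrier G" "h \<in> H" "y = g \<otimes> h \<otimes> inv g" by blast
    obtain v h0 where vh: "v \<in> V" "h0 \<in> H" "g = v \<otimes> h0" using decompose[OF gh(1)] .
    \<comment> \<open>The part \<open>h0\<close> of the conjugator is absorbed into
      \<open>h'\<close>; the remaining conjugate \<open>v h' v^-1\<close> equals
      \<open>[v^-1, h'^-1] h'\<close>.\<close>
    define h' where "h' = h0 \<otimes> h \<otimes> inv h0"
    have h': "h' \<in> H" using gh vh by (simp add: h'_def)
    have "y = v \<otimes> h' \<otimes> inv v" using gh vh by (simp add: h'_def word_simps)
    also have "\<dots> = comm_elt G (inv v) (inv h') \<otimes> h'" using vh h' by (simp add: comm_elt_def word_simps)
    finally have "y = comm_elt G (inv v) (inv h') \<otimes> h'" .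
    moreover have "comm_elt G (inv v) (inv h') \<in> W"
      unfolding W_def comm_subgroup_def using vh h' by (intro generate.incl) blast
    ultimately show "y \<in> W <#> H" using h' unfolding set_mult_def by blast
  qed
  hence "V \<subseteq> W <#> H" using assms(1) V.subset unfolding contranormal_def by blast
  hence "finite_cover G V W" by (rule finite_coverI[OF H_finite H.subset])
  thus ?thesis using nofi[OF Wsub W(2)] by (simp add: W_def)
qed

end

locale divisible_by_finite = abelian_by_finite +
  assumes V_torsion: "\<And>x. x \<in> V \<Longrightarrow> power_torsion G n x"
    and V_divisible: "power_divisible G n V"
    and V_commutator: "comm_subgroup G V H = V"
begin

lemma pow_VG: "x [^]\<^bsub>VG\<^esub> (m::nat) = x [^] m"
  by (simp add: nat_pow_consistent[symmetric])

lemma power_divisible_iterate: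
  assumes "power_divisible G n A" "A \<subseteq> carrier G" "x \<in> A"
  shows "\<exists>y\<in>A. y [^] (n ^ k) = x"
  using assms(3)
proof (induction k arbitrary: x)
  case 0
  thus ?case using assms(2) by (intro bexI[of _ x]) auto
next
  case (Suc k)
  obtain y where y: "y \<in> A" "y [^] n = x" using assms(1) Suc.prems unfolding power_divisible_def by blast
  obtain z where z: "z \<in> A" "z [^] (n ^ k) = y" using Suc.IH[OF y(1)] by blast
  have "z [^] (n ^ Suc k) = x" using z y assms(2) by (auto simp: nat_pow_pow mult.commute)
  thus ?case using z by blast
qed

lemma exponent_divisible_trivial:
  assumes "power_divisible G n A" "A \<subseteq> carrier G" "\<And>x. x \<in> A \<Longrightarrow> x [^] (n ^ k) = \<one>"
  shows "A \<subseteq> {\<one>}"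
  using power_divisible_iterate[OF assms(1,2), of _ k] assms(3) by fastforce

text \<open>Maschke's argument: averaging a projection with kernel \<open>S\<close> over the finite group
  \<open>H\<close> makes it commute with conjugation, at the price of multiplying by \<open>n\<close>
  modulo \<open>S\<close>.\<close>
lemma maschke:
  assumes "S \<lhd> G" "S \<subseteq> V" "power_divisible G n S"
  obtains \<rho> where "\<And>x. x \<in> V \<Longrightarrow> \<rho> x \<in> V"
    "\<And>x y. \<lbrakk>x \<in> V; y \<in> V\<rbrakk> \<Longrightarrow> \<rho> (x \<otimes> y) = \<rho> x \<otimes> \<rho> y"
    "\<And>s. s \<in> S \<Longrightarrow> \<rho> s = \<one>"
    "\<And>x. x \<in> V \<Longrightarrow> \<exists>s\<in>S. \<rho> x = s \<otimes> x [^] n"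
    "\<And>g x. \<lbrakk>g \<in> carrier G; x \<in> V\<rbrakk> \<Longrightarrow> \<rho> (g \<otimes> x \<otimes> inv g) = g \<otimes> \<rho> x \<otimes> inv g"
proof -
  interpret S: normal S G by fact
  have SV: "subgroup S VG" by (rule subgroup_incl[OF S.subgroup_axioms V.subgroup_axioms assms(2)])
  obtain q where q: "q \<in> hom VG VG" "\<And>s. s \<in> S \<Longrightarrow> q s = \<one>"
      "\<And>x. x \<in> V \<Longrightarrow> \<exists>s\<in>S. q x = s \<otimes> x"
  proof (rule VG.divisible_projection[OF SV n_pos])
    show "power_torsion VG n x" if "x \<in> carrier VG" for x
      using V_torsion that by (simp add: power_torsion_def pow_VG)
    show "\<exists>t\<in>S. t [^]\<^bsub>VG\<^esub> n = s" if "s \<in> S" for s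
      using assms(3) that unfolding pow_VG power_divisible_def by blast
  qed auto
  have qV: "q x \<in> V" if "x \<in> V" for x using q(1) that by (auto simp: hom_def)
  have qm: "q (x \<otimes> y) = q x \<otimes> q y" if "x \<in> V" "y \<in> V" for x y using q(1) that by (auto simp: hom_def)
  \<comment> \<open>\<open>f x h\<close> is the conjugate of the projection \<open>q\<close> by
    \<open>h\<close>, evaluated at \<open>x\<close>; \<open>\<rho>\<close> is the product of these
    maps over \<open>H\<close>.\<close>
  define f where "f x h = h \<otimes> q (inv h \<otimes> x \<otimes> h) \<otimes> inv h" for x h
  have fV: "f x h \<in> V" if "x \<in> V" "h \<in> H" for x h
    unfolding f_def using that by (intro V.inv_op_closed2 qV V.inv_op_closed1) auto
  define \<rho> where "\<rho> x = finprod VG (f x) H" for x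
  have conj: "inv h \<otimes> x \<otimes> h \<in> V" if "x \<in> V" "h \<in> H" for x h
    using that by (intro V.inv_op_closed1) auto
  have inj: "inj_on (\<lambda>h. k \<otimes> h) H" if "k \<in> H" for k
    using that by (intro inj_onI) simp
  have img: "(\<lambda>h. k \<otimes> h) ` H = H" if "k \<in> H" for k
  proof (rule card_subset_eq[OF H_finite])
    show "card ((\<lambda>h. k \<otimes> h) ` H) = card H" by (rule card_image[OF inj[OF that]])
  qed (use that in auto)
  have finprod_conj: "finprod VG (\<lambda>h. k \<otimes> u h \<otimes> inv k) F = k \<otimes> finprod VG u F \<otimes> inv k"
    if "k \<in> H" "finite F" "\<And>h. h \<in> F \<Longrightarrow> u h \<in> V" for k u F
    using that(2,3)
  proof (induction F rule: finite_induct)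
    case (insert a F)
    have uF: "u \<in> F \<rightarrow> carrier VG" "u a \<in> carrier VG" using insert.prems by auto
    have cF: "(\<lambda>h. k \<otimes> u h \<otimes> inv k) \<in> F \<rightarrow> carrier VG" "k \<otimes> u a \<otimes> inv k \<in> carrier VG"
      using insert.prems that(1) by (auto intro: V.inv_op_closed2)
    have pF: "finprod VG u F \<in> V" using VG.finprod_closed[OF uF(1)] by simp
    have "finprod VG (\<lambda>h. k \<otimes> u h \<otimes> inv k) (insert a F)
        = (k \<otimes> u a \<otimes> inv k) \<otimes> finprod VG (\<lambda>h. k \<otimes> u h \<otimes> inv k) F"
      using VG.finprod_insert[OF insert.hyps cF] by simp
    also have "\<dots> = (k \<otimes> u a \<otimes> inv k) \<otimes> (k \<otimes> finprod VG u F \<otimes> inv k)"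
      using insert by simp
    also have "\<dots> = k \<otimes> (u a \<otimes> finprod VG u F) \<otimes> inv k"
      using that(1) pF uF(2) by (simp add: word_simps)
    finally show ?case using VG.finprod_insert[OF insert.hyps uF] by simp
  qed (use that in simp)
  show ?thesis
  proof (rule that[of \<rho>])
    show "\<rho> x \<in> V" if "x \<in> V" for x
      unfolding \<rho>_def using VG.finprod_closed[of "f x" H] fV[OF that] by (auto simp: Pi_def)
    show "\<rho> (x \<otimes> y) = \<rho> x \<otimes> \<rho> y" if xy: "x \<in> V" "y \<in> V" for x y
    proof -
      have "f (x \<otimes> y) h = f x h \<otimes> f y h" if h: "h \<in> H" for h
      proof -
        have "inv h \<otimes> (x \<otimes> y) \<otimes> h = (inv h \<otimes> x \<otimes> h) \<otimes> (inv h \<otimes> y \<otimes> h)"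
          using xy h by (simp add: word_simps)
        hence "q (inv h \<otimes> (x \<otimes> y) \<otimes> h) = q (inv h \<otimes> x \<otimes> h) \<otimes> q (inv h \<otimes> y \<otimes> h)"
          using qm[OF conj[OF xy(1) h] conj[OF xy(2) h]] by simp
        thus ?thesis unfolding f_def using h qV[OF conj[OF xy(1) h]] qV[OF conj[OF xy(2) h]]
          by (simp add: word_simps)
      qed
      hence "\<rho> (x \<otimes> y) = finprod VG (\<lambda>h. f x h \<otimes>\<^bsub>VG\<^esub> f y h) H"
        unfolding \<rho>_def by (intro VG.finprod_cong') (auto simp: fV xy)
      also have "\<dots> = \<rho> x \<otimes> \<rho> y"
        unfolding \<rho>_def using fV xy by (subst VG.finprod_multf) auto
      finally show ?thesis .
    qed
    show "\<rho> s = \<one>" if s: "s \<in> S" for s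
    proof -
      have "f s h = \<one>\<^bsub>VG\<^esub>" if "h \<in> H" for h
        unfolding f_def using q(2)[OF S.inv_op_closed1[OF _ s]] that by simp
      thus ?thesis unfolding \<rho>_def using VG.finprod_one_eqI[of H "f s"] by simp
    qed
    show "\<exists>s\<in>S. \<rho> x = s \<otimes> x [^] n" if x: "x \<in> V" for x
    proof -
      \<comment> \<open>Modulo \<open>S\<close> each conjugate of \<open>q\<close> is the identity,
        so each of the \<open>n\<close> factors contributes one \<open>x\<close>.\<close>
      have summand: "\<exists>s\<in>S. f x h = s \<otimes> x" if h: "h \<in> H" for h
      proof -
        obtain s where s: "s \<in> S" "q (inv h \<otimes> x \<otimes> h) = s \<otimes> (inv h \<otimes> x \<otimes> h)"
          using q(3)[OF conj[OF x h]] by blast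
        have "f x h = (h \<otimes> s \<otimes> inv h) \<otimes> x"
          unfolding f_def s(2) using s(1) x h by (simp add: word_simps)
        moreover have "h \<otimes> s \<otimes> inv h \<in> S" by (rule S.inv_op_closed2[OF H.mem_carrier[OF h] s(1)])
        ultimately show ?thesis by blast
      qed
      have "\<exists>s\<in>S. finprod VG (f x) F = s \<otimes> x [^] card F" if "finite F" "F \<subseteq> H" for F
        using that
      proof (induction F rule: finite_induct)
        case empty
        thus ?case by (intro bexI[of _ \<one>]) auto
      next
        case (insert a F)
        obtain s where s: "s \<in> S" "finprod VG (f x) F = s \<otimes> x [^] card F" using insert by blast
        obtain t where t: "t \<in> S" "f x a = t \<otimes> x" using summand insert.prems by blast
        have "finprod VG (f x) (insert a F) = f x a \<otimes> finprod VG (f x) F"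
          using VG.finprod_insert[OF insert.hyps, of "f x"] insert.prems fV[OF x] by (auto simp: Pi_def)
        also have "\<dots> = (t \<otimes> x) \<otimes> (s \<otimes> x [^] card F)" using s t by simp
        also have "\<dots> = t \<otimes> (x \<otimes> s) \<otimes> x [^] card F" using s t x by (simp add: m_assoc)
        also have "x \<otimes> s = s \<otimes> x" using s x assms(2) by (intro V_comm) auto
        also have "t \<otimes> (s \<otimes> x) \<otimes> x [^] card F = (t \<otimes> s) \<otimes> x [^] card (insert a F)"
          using s t x insert.hyps nat_pow_Suc2[OF V.mem_carrier[OF x], of "card F"] by (simp add: m_assoc)
        finally show ?case using s t by blast
      qed
      thus ?thesis unfolding \<rho>_def using H_finite by blast
    qed
    show "\<rho> (g \<otimes> x \<otimes> inv g) = g \<otimes> \<rho> x \<otimes> inv g" if g: "g \<in> carrier G" and x: "x \<in> V" for g x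
    proof -
      obtain v k where vk: "v \<in> V" "k \<in> H" "g = v \<otimes> k" using decompose[OF g] .
      let ?x = "k \<otimes> x \<otimes> inv k"
      have xV: "?x \<in> V" using x vk by (intro V.inv_op_closed2) auto
      \<comment> \<open>Left multiplication by \<open>k\<close> permutes \<open>H\<close>, so
        replacing \<open>h\<close> by \<open>k \<otimes> h\<close> only reorders the
        product.\<close>
      have "finprod VG (f ?x) ((\<lambda>h. k \<otimes> h) ` H) = finprod VG (\<lambda>h. f ?x (k \<otimes> h)) H"
        by (rule VG.finprod_reindex[OF _ inj[OF vk(2)]]) (auto simp: img vk fV xV)
      hence "\<rho> ?x = finprod VG (\<lambda>h. f ?x (k \<otimes> h)) H" unfolding \<rho>_def img[OF vk(2)] .
      also have "\<dots> = finprod VG (\<lambda>h. k \<otimes> f x h \<otimes> inv k) H"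
      proof (rule VG.finprod_cong')
        show "f ?x (k \<otimes> h) = k \<otimes> f x h \<otimes> inv k" if h: "h \<in> H" for h
        proof -
          have "inv (k \<otimes> h) \<otimes> ?x \<otimes> (k \<otimes> h) = inv h \<otimes> x \<otimes> h"
            using h vk x by (simp add: word_simps)
          thus ?thesis unfolding f_def using h vk qV[OF conj[OF x h]] by (simp add: word_simps)
        qed
        show "(\<lambda>h. k \<otimes> f x h \<otimes> inv k) \<in> H \<rightarrow> carrier VG"
          using V.inv_op_closed2[OF H.mem_carrier[OF vk(2)] fV[OF x]] by simp
      qed simp
      also have "\<dots> = k \<otimes> \<rho> x \<otimes> inv k"
        unfolding \<rho>_def by (rule finprod_conj[OF vk(2) H_finite fV[OF x]])
      finally show ?thesis
        using conj_decompose[OF x vk(1,2)] conj_decompose[of "\<rho> x" v k] vk \<open>\<And>x. x \<in> V \<Longrightarrow> \<rho> x \<in> V\<close>[OF x]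
        by simp
    qed
  qed
qed

section \<open>Quasifinite invariant subgroups\<close>

lemma power_image_normal:
  assumes "E \<lhd> G" "E \<subseteq> V"
  shows "(\<lambda>x. x [^] (m::nat)) ` E \<lhd> G" "(\<lambda>x. x [^] m) ` E \<subseteq> E"
proof -
  interpret E: normal E G by fact
  have pw: "x [^] m \<in> E" if "x \<in> E" for x by (rule subgroup_nat_pow_closed[OF E.subgroup_axioms that])
  thus "(\<lambda>x. x [^] m) ` E \<subseteq> E" by blast
  show "(\<lambda>x. x [^] m) ` E \<lhd> G"
  proof (rule normal_invI)
    show "subgroup ((\<lambda>x. x [^] m) ` E) G"
    proof (rule subgroupI)
      show "(\<lambda>x. x [^] m) ` E \<subseteq> carrier G" using pw E.subset by blast
      show "(\<lambda>x. x [^] m) ` E \<noteq> {}" using E.one_closed by blast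
      show "inv a \<in> (\<lambda>x. x [^] m) ` E" if a: "a \<in> (\<lambda>x. x [^] m) ` E" for a
      proof -
        obtain x where x: "x \<in> E" "a = x [^] m" using a by blast
        hence "inv a = inv x [^] m" "inv x \<in> E" by (simp_all add: nat_pow_inv)
        thus ?thesis by blast
      qed
      show "a \<otimes> b \<in> (\<lambda>x. x [^] m) ` E"
        if a: "a \<in> (\<lambda>x. x [^] m) ` E" and b: "b \<in> (\<lambda>x. x [^] m) ` E" for a b
      proof -
        obtain x y where xy: "x \<in> E" "a = x [^] m" "y \<in> E" "b = y [^] m" using a b by blast
        have "a \<otimes> b = (x \<otimes> y) [^] m" using xy assms(2) by (simp add: V_pow_mult subsetD)
        moreover have "x \<otimes> y \<in> E" using xy by simp
        ultimately show ?thesis by blast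
      qed
    qed
    show "g \<otimes> a \<otimes> inv g \<in> (\<lambda>x. x [^] m) ` E"
      if g: "g \<in> carrier G" and a: "a \<in> (\<lambda>x. x [^] m) ` E" for g a
    proof -
      obtain x where x: "x \<in> E" "a = x [^] m" using a by blast
      have "g \<otimes> a \<otimes> inv g = (g \<otimes> x \<otimes> inv g) [^] m" using x g by (simp add: conj_pow)
      moreover have "g \<otimes> x \<otimes> inv g \<in> E" by (rule E.inv_op_closed2[OF g x(1)])
      ultimately show ?thesis by blast
    qed
  qed
qed

text \<open>The fibres of the power map lie in translates of the finite set of elements killed by
  \<open>n\<close>, so an infinite domain has an infinite image.\<close>

lemma infinite_power_image:
  assumes "E \<lhd> G" "E \<subseteq> V" "infinite E" "finite {x \<in> E. x [^] n = \<one>}"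
  shows "infinite ((\<lambda>x. x [^] n) ` E)"
proof
  interpret E: normal E G by fact
  assume "finite ((\<lambda>x. x [^] n) ` E)"
  then obtain a where a: "a \<in> E" "infinite {x \<in> E. x [^] n = a [^] n}"
    using pigeonhole_infinite[OF assms(3)] by blast
  have "{x \<in> E. x [^] n = a [^] n} \<subseteq> (\<lambda>t. t \<otimes> a) ` {x \<in> E. x [^] n = \<one>}"
  proof
    fix x assume x: "x \<in> {x \<in> E. x [^] n = a [^] n}"
    have "(x \<otimes> inv a) [^] n = x [^] n \<otimes> inv (a [^] n)"
      using x a assms(2) by (simp add: V_pow_mult nat_pow_inv subsetD)
    hence "x \<otimes> inv a \<in> {x \<in> E. x [^] n = \<one>}" using x a by simp
    moreover have "x = x \<otimes> inv a \<otimes> a" using x a by (simp add: m_assoc)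
    ultimately show "x \<in> (\<lambda>t. t \<otimes> a) ` {x \<in> E. x [^] n = \<one>}" by blast
  qed
  thus False using a(2) assms(4) finite_surj by blast
qed

text \<open>An infinite invariant subgroup with the fewest elements of exponent \<open>n\<close> is
  divisible and determined by these elements, hence quasifinite.\<close>
lemma quasifinite_exists:
  assumes "E \<lhd> G" "E \<subseteq> V" "infinite E" "finite {x \<in> E. x [^] n = \<one>}"
  obtains D where "D \<lhd> G" "D \<subseteq> E" "quasifinite G D" "power_divisible G n D"
proof -
  define tor where "tor Y = {x \<in> Y. x [^] n = \<one>}" for Y
  define P where "P Y \<longleftrightarrow> Y \<lhd> G \<and> Y \<subseteq> E \<and> infinite Y" for Y
  let ?pw = "\<lambda>Y. (\<lambda>x. x [^] n) ` Y"
  have "P E" using assms by (simp add: P_def)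
  then obtain D where D: "P D" and min: "\<And>Y. P Y \<Longrightarrow> card (tor D) \<le> card (tor Y)"
    using ex_has_least_nat[of P E "\<lambda>Y. card (tor Y)"] by blast
  have fin: "finite (tor Y)" if "P Y" for Y
    using that assms(4) by (auto simp: P_def tor_def intro: finite_subset[of _ "{x \<in> E. x [^] n = \<one>}"])
  have pw: "P (?pw Y)" if "P Y" for Y
    using power_image_normal[of Y n] infinite_power_image[of Y] fin[OF that] that assms(2)
    unfolding P_def tor_def by blast
  have tor_eq: "tor Z = tor Y" if "P Y" "P Z" "Z \<subseteq> Y" "card (tor Y) = card (tor D)" for Y Z
  proof (rule card_seteq[OF fin[OF that(1)]])
    show "tor Z \<subseteq> tor Y" using that(3) by (auto simp: tor_def)
    show "card (tor Y) \<le> card (tor Z)" using min[OF that(2)] that(4) by simp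
  qed
  have pw_sub: "?pw Y \<subseteq> Y" if "P Y" for Y
    using power_image_normal(2)[of Y n] that assms(2) unfolding P_def by blast
  \<comment> \<open>Equal \<open>n\<close>-th powers mean that \<open>d\<close> and \<open>f\<close>
    differ by an element killed by \<open>n\<close>, and all such elements of \<open>Y\<close> lie
    in \<open>Z\<close>.\<close>
  have quot: "d \<in> Z" if Y: "P Y" and Z: "P Z" and sub: "Z \<subseteq> Y" and tor: "tor Z = tor Y"
    and d: "d \<in> Y" and f: "f \<in> Z" "d [^] n = f [^] n" for Y Z d f
  proof -
    interpret Y: normal Y G using Y unfolding P_def by blast
    interpret Z: normal Z G using Z unfolding P_def by blast
    have fY: "f \<in> Y" and dV: "d \<in> V" and fV: "f \<in> V"
      using f d sub Y assms(2) unfolding P_def by auto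
    have "(d \<otimes> inv f) [^] n = d [^] n \<otimes> inv (f [^] n)" using dV fV by (simp add: V_pow_mult nat_pow_inv)
    hence "d \<otimes> inv f \<in> tor Y" using d fY f fV by (simp add: tor_def)
    hence "d \<otimes> inv f \<in> Z" using tor by (auto simp: tor_def)
    hence "d \<otimes> inv f \<otimes> f \<in> Z" using f by simp
    thus ?thesis using dV fV by (simp add: m_assoc)
  qed
  \<comment> \<open>\<open>Y\<close> is kept arbitrary in the induction because the hypothesis for
    \<open>d [^] n\<close> is applied to the subgroup of \<open>n\<close>-th powers of
    \<open>Y\<close>.\<close>
  have div: "d \<in> ?pw Y" if "P Y" "card (tor Y) = card (tor D)" "d \<in> Y" "d [^] (n ^ j) = \<one>" for Y d j
    using that
  proof (induction j arbitrary: Y d)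
    case 0
    have "d \<in> carrier G" using 0 assms(2) V.subset by (auto simp: P_def)
    hence "d = \<one>" using 0 by simp
    moreover have "\<one> \<in> ?pw Y"
      using pw[OF 0(1)] subgroup.one_closed[OF normal_imp_subgroup] unfolding P_def by blast
    ultimately show ?case by simp
  next
    case (Suc j)
    have dc: "d \<in> carrier G" using Suc.prems assms(2) V.subset by (auto simp: P_def)
    have tY: "tor (?pw Y) = tor Y"
      by (rule tor_eq[OF Suc.prems(1) pw[OF Suc.prems(1)] pw_sub[OF Suc.prems(1)] Suc.prems(2)])
    have "d [^] n \<in> ?pw (?pw Y)"
    proof (rule Suc.IH[OF pw[OF Suc.prems(1)]])
      show "card (tor (?pw Y)) = card (tor D)" using tY Suc.prems(2) by simp
      show "d [^] n \<in> ?pw Y" using Suc.prems(3) by blast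
      show "(d [^] n) [^] (n ^ j) = \<one>" using Suc.prems(4) dc by (simp add: nat_pow_pow)
    qed
    then obtain f where "f \<in> ?pw Y" "d [^] n = f [^] n" by blast
    thus ?case using quot[OF Suc.prems(1) pw[OF Suc.prems(1)] pw_sub[OF Suc.prems(1)] tY Suc.prems(3)] by blast
  qed
  have divisible: "power_divisible G n Y" if Y: "P Y" "card (tor Y) = card (tor D)" for Y
    unfolding power_divisible_def
  proof
    fix x assume x: "x \<in> Y"
    hence "power_torsion G n x" using Y assms(2) V_torsion unfolding P_def by blast
    then obtain j where "x [^] (n ^ j) = \<one>" by (auto simp: power_torsion_def)
    thus "\<exists>y\<in>Y. y [^] n = x" using div[OF Y x] by blast
  qed
  show ?thesis
  proof (rule that[of D])
    have DP: "D \<lhd> G" "D \<subseteq> E" "infinite D" using D unfolding P_def by auto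
    show "D \<lhd> G" "D \<subseteq> E" by fact+
    show "power_divisible G n D" by (rule divisible[OF D refl])
    show "quasifinite G D"
      unfolding quasifinite_def
    proof (intro conjI allI impI)
      show "abelian_subset G D"
        using DP assms(2) V_comm unfolding abelian_subset_def by blast
      fix B assume B: "B \<subset> D \<and> B \<lhd> G"
      show "finite B"
      proof (rule ccontr)
        assume "infinite B"
        hence PB: "P B" using B DP unfolding P_def by blast
        have BD: "B \<subseteq> D" using B by blast
        have tB: "tor B = tor D" by (rule tor_eq[OF D PB BD refl])
        have divB: "power_divisible G n B" using divisible[OF PB] tB by simp
        \<comment> \<open>Since \<open>B\<close> is divisible and contains every element of
          \<open>D\<close> killed by \<open>n\<close>, induction on \<open>j\<close> puts all of
          \<open>D\<close> into \<open>B\<close>.\<close>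
        have "d \<in> B" if "d \<in> D" "d [^] (n ^ j) = \<one>" for d j
          using that
        proof (induction j arbitrary: d)
          case 0
          have "d \<in> carrier G" using 0 DP assms(2) V.subset by blast
          hence "d = \<one>" using 0 by simp
          thus ?case using subgroup.one_closed[OF normal_imp_subgroup] B by blast
        next
          case (Suc j)
          have dc: "d \<in> carrier G" using Suc.prems DP assms(2) V.subset by blast
          have "d [^] n \<in> B"
          proof (rule Suc.IH)
            show "d [^] n \<in> D"
              by (rule subgroup_nat_pow_closed[OF normal_imp_subgroup[OF DP(1)] Suc.prems(1)])
            show "(d [^] n) [^] (n ^ j) = \<one>" using Suc.prems(2) dc by (simp add: nat_pow_pow)
          qed
          then obtain f where f: "f \<in> B" "d [^] n = f [^] n"
            using divB unfolding power_divisible_def by metis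
          show ?case by (rule quot[OF D PB BD tB Suc.prems(1) f])
        qed
        hence "D \<subseteq> B" using DP(2) assms(2) V_torsion unfolding power_torsion_def by blast
        thus False using B by blast
      qed
    qed fact+
  qed
qed

text \<open>\<open>E\<close> is the normal closure of a tower of \<open>n\<close>-th roots, a union of finite subgroups with
  \<open>n\<close> generators each.\<close>
lemma finite_rank_subgroup_exists:
  assumes "S \<lhd> G" "S \<subseteq> V" "power_divisible G n S" "v \<in> S" "v \<noteq> \<one>"
  obtains E where "E \<lhd> G" "E \<subseteq> S" "infinite E" "finite {x \<in> E. x [^] n = \<one>}"
proof -
  interpret S: normal S G by fact
  obtain r where r: "\<And>x. x \<in> S \<Longrightarrow> r x \<in> S \<and> r x [^] n = x"
    using assms(3) unfolding power_divisible_def by metis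
  \<comment> \<open>Starting from \<open>v\<close>, chosen \<open>n\<close>-th roots in
    \<open>S\<close> are taken repeatedly, so that \<open>w i\<close> is an \<open>n ^ i\<close>-th
    root of \<open>v\<close>.\<close>
  define w where "w i = (r ^^ i) v" for i
  have wS: "w i \<in> S" for i unfolding w_def by (induction i) (use assms(4) r in auto)
  have w_Suc: "w (Suc i) [^] n = w i" for i using r[OF wS[of i]] by (simp add: w_def)
  have w_pow: "w i [^] (n ^ i) = v" for i
  proof (induction i)
    case (Suc i)
    have "w (Suc i) [^] (n ^ Suc i) = (w (Suc i) [^] n) [^] (n ^ i)"
      using wS by (simp add: nat_pow_pow)
    thus ?case using Suc w_Suc by simp
  qed (use assms(4) in \<open>simp add: w_def\<close>)
  define Y where "Y i = (\<lambda>h. h \<otimes> w i \<otimes> inv h) ` H" for i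
  have YS: "Y i \<subseteq> S" for i
    unfolding Y_def using S.inv_op_closed2[OF H.mem_carrier wS] by blast
  hence YV: "Y i \<subseteq> V" for i using assms(2) by blast
  define E where "E i = generate G (Y i)" for i
  have E_normal: "E i \<lhd> G" for i
    unfolding E_def
  proof (rule normal_generate[OF YV])
    fix y k assume "y \<in> Y i" and k: "k \<in> H"
    then obtain h where h: "h \<in> H" "y = h \<otimes> w i \<otimes> inv h" unfolding Y_def by blast
    have "k \<otimes> y \<otimes> inv k = (k \<otimes> h) \<otimes> w i \<otimes> inv (k \<otimes> h)"
      using h k wS by (simp add: word_simps)
    moreover have "k \<otimes> h \<in> H" using h k by simp
    ultimately show "k \<otimes> y \<otimes> inv k \<in> Y i" unfolding Y_def by blast
  qed
  have E_sub: "subgroup (E i) G" for i by (rule normal_imp_subgroup[OF E_normal])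
  have ES: "E i \<subseteq> S" for i unfolding E_def by (rule generate_subgroup_incl[OF YS S.subgroup_axioms])
  have E_Suc: "E i \<subseteq> E (Suc i)" for i
    unfolding E_def[of i]
  proof (rule generate_subgroup_incl[OF _ E_sub], rule subsetI)
    fix y assume "y \<in> Y i"
    then obtain h where h: "h \<in> H" "y = h \<otimes> w i \<otimes> inv h" unfolding Y_def by blast
    hence "y = (h \<otimes> w (Suc i) \<otimes> inv h) [^] n" using wS by (simp add: conj_pow w_Suc)
    moreover have "h \<otimes> w (Suc i) \<otimes> inv h \<in> E (Suc i)"
      unfolding E_def Y_def using h by (intro generate.incl) blast
    ultimately show "y \<in> E (Suc i)" using subgroup_nat_pow_closed[OF E_sub] by simp
  qed
  have mono: "E i \<subseteq> E j" if "i \<le> j" for i j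
    by (rule lift_Suc_mono_le[of E, OF E_Suc that])
  have wE: "w i \<in> E i" for i
  proof -
    have "w i = \<one> \<otimes> w i \<otimes> inv \<one>" using wS by simp
    hence "w i \<in> Y i" unfolding Y_def using H.one_closed by blast
    thus ?thesis unfolding E_def by (rule generate.incl)
  qed
  \<comment> \<open>\<open>Y i\<close> is an orbit under \<open>H\<close> and has at most
    \<open>n\<close> elements, so the bound \<open>n ^ n\<close> does not depend on
    \<open>i\<close>.\<close>
  have card: "card {x \<in> E i. x [^] n = \<one>} \<le> n ^ n" and finE: "finite (E i)" for i
  proof -
    have fin: "finite (Y i)" unfolding Y_def using H_finite by simp
    have gen: "generate VG (Y i) = E i"
      unfolding E_def by (rule generate_consistent[OF YV V.subgroup_axioms])
    have tors: "power_torsion VG n y" if "y \<in> Y i" for y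
      using V_torsion YV that unfolding power_torsion_def pow_VG by auto
    have "card {x \<in> E i. x [^] n = \<one>} \<le> n ^ card (Y i)"
      using VG.card_exponent_le[OF fin _ n_pos tors] YV by (simp add: gen pow_VG)
    also have "\<dots> \<le> n ^ n"
      unfolding Y_def using n_pos card_image_le[OF H_finite] by (intro power_increasing) auto
    finally show "card {x \<in> E i. x [^] n = \<one>} \<le> n ^ n" .
    show "finite (E i)"
      using VG.finite_generate_torsion[OF fin _ n_pos tors] YV by (simp add: gen)
  qed
  define U where "U = (\<Union>i. E i)"
  have chain: "E i \<subseteq> E j \<or> E j \<subseteq> E i" for i j using mono[of i j] mono[of j i] by (cases "i \<le> j") auto
  have U_normal: "U \<lhd> G"
  proof (rule normal_invI)
    show "subgroup U G"
      unfolding U_def by (rule Union_chain_subgroup) (use E_sub chain in auto)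
    show "x \<otimes> h \<otimes> inv x \<in> U" if "x \<in> carrier G" "h \<in> U" for x h
      using that normal.inv_op_closed2[OF E_normal] unfolding U_def by blast
  qed
  have US: "U \<subseteq> S" unfolding U_def using ES by blast
  \<comment> \<open>A finite \<open>U\<close> would be killed by some \<open>n ^ k\<close>, but
    \<open>w k [^] (n ^ k) = v\<close> is nontrivial.\<close>
  have U_inf: "infinite U"
  proof
    assume fin: "finite U"
    have Uc: "U \<subseteq> carrier VG" using US assms(2) by auto
    have Ut: "power_torsion VG n y" if "y \<in> U" for y
      using V_torsion US assms(2) that unfolding power_torsion_def pow_VG by auto
    obtain k where k: "\<forall>y\<in>U. y [^] (n ^ k) = \<one>"
      using VG.finite_power_torsion_uniform[OF fin Uc Ut] unfolding pow_VG by auto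
    have "w k \<in> U" unfolding U_def using wE by blast
    thus False using k w_pow[of k] assms(5) by auto
  qed
  have "finite {x \<in> U. x [^] n = \<one>}"
  proof (rule ccontr)
    assume "infinite {x \<in> U. x [^] n = \<one>}"
    \<comment> \<open>One element more than the uniform bound allows: the finite set
      \<open>B\<close> already lies in a single member of the chain.\<close>
    then obtain B where B: "finite B" "card B = Suc (n ^ n)" "B \<subseteq> {x \<in> U. x [^] n = \<one>}"
      using infinite_arbitrarily_large by blast
    have "\<exists>i. B \<subseteq> E i"
      using B(1) B(3)
    proof (induction B rule: finite_induct)
      case (insert b B)
      obtain i where i: "B \<subseteq> E i" using insert by blast
      obtain j where j: "b \<in> E j" using insert.prems unfolding U_def by blast
      have "insert b B \<subseteq> E (max i j)" using i j mono[of i "max i j"] mono[of j "max i j"] by auto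
      thus ?case by blast
    qed simp
    then obtain i where i: "B \<subseteq> E i" by blast
    have "card B \<le> card {x \<in> E i. x [^] n = \<one>}"
      using B i finE by (intro card_mono) auto
    thus False using card[of i] B(2) by simp
  qed
  thus ?thesis using that[OF U_normal US U_inf] by blast
qed

lemma quasifinite_subgroup_exists:
  assumes "S \<lhd> G" "S \<subseteq> V" "power_divisible G n S" "v \<in> S" "v \<noteq> \<one>"
  obtains D where "D \<lhd> G" "D \<subseteq> S" "quasifinite G D" "power_divisible G n D"
proof -
  obtain E where E: "E \<lhd> G" "E \<subseteq> S" "infinite E" "finite {x \<in> E. x [^] n = \<one>}"
    by (rule finite_rank_subgroup_exists[OF assms])
  show ?thesis
    by (rule quasifinite_exists[OF E(1) order_trans[OF E(2) assms(2)] E(3,4)])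
      (use E(2) that in blast)
qed

text \<open>\<open>T\<close> is the image of the averaged projection \<open>\<rho>\<close> of
  \<open>maschke\<close>. Modulo \<open>S\<close> this map is the \<open>n\<close>-th power, whence
  the fourth property. \<open>S\<close> and \<open>T\<close> may overlap, but only in elements
  killed by \<open>n\<close>, so no nontrivial divisible subgroup lies in both.\<close>

lemma almost_complement:
  assumes "S \<lhd> G" "S \<subseteq> V" "power_divisible G n S"
  obtains T where "T \<lhd> G" "T \<subseteq> V" "power_divisible G n T"
    "\<And>x. x \<in> V \<Longrightarrow> \<exists>s\<in>S. s \<otimes> x [^] n \<in> T"
    "\<And>D. \<lbrakk>D \<subseteq> S; D \<subseteq> T; power_divisible G n D\<rbrakk> \<Longrightarrow> D \<subseteq> {\<one>}"
proof -
  interpret S: normal S G by fact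
  obtain \<rho> where V: "\<And>x. x \<in> V \<Longrightarrow> \<rho> x \<in> V"
    and mult: "\<And>x y. \<lbrakk>x \<in> V; y \<in> V\<rbrakk> \<Longrightarrow> \<rho> (x \<otimes> y) = \<rho> x \<otimes> \<rho> y"
    and S: "\<And>s. s \<in> S \<Longrightarrow> \<rho> s = \<one>"
    and pow: "\<And>x. x \<in> V \<Longrightarrow> \<exists>s\<in>S. \<rho> x = s \<otimes> x [^] n"
    and conj: "\<And>g x. \<lbrakk>g \<in> carrier G; x \<in> V\<rbrakk> \<Longrightarrow> \<rho> (g \<otimes> x \<otimes> inv g) = g \<otimes> \<rho> x \<otimes> inv g"
  proof (rule maschke[OF assms], goal_cases)
    case (1 \<rho>)
    from 1(2-) show ?case by (rule 1(1))
  qed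
  interpret \<rho>: group_hom VG VG \<rho>
    using V mult by unfold_locales (auto simp: hom_def)
  have \<rho>_pow: "\<rho> (x [^] (m::nat)) = \<rho> x [^] m" if "x \<in> V" for x m
    using \<rho>.hom_nat_pow[of x m] that unfolding pow_VG by simp
  show ?thesis
  proof (rule that[of "\<rho> ` V"])
    show "\<rho> ` V \<lhd> G"
    proof (rule normal_invI)
      have "subgroup (\<rho> ` carrier VG) VG" by (rule \<rho>.img_is_subgroup)
      thus "subgroup (\<rho> ` V) G" using incl_subgroup[OF V.subgroup_axioms] by simp
      show "g \<otimes> y \<otimes> inv g \<in> \<rho> ` V" if g: "g \<in> carrier G" and y: "y \<in> \<rho> ` V" for g y
      proof -
        obtain x where x: "x \<in> V" "y = \<rho> x" using y by blast
        have "g \<otimes> y \<otimes> inv g = \<rho> (g \<otimes> x \<otimes> inv g)" using conj[OF g x(1)] x(2) by simp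
        moreover have "g \<otimes> x \<otimes> inv g \<in> V" by (rule V.inv_op_closed2[OF g x(1)])
        ultimately show ?thesis by blast
      qed
    qed
    show "\<rho> ` V \<subseteq> V" using V by blast
    show "power_divisible G n (\<rho> ` V)"
      unfolding power_divisible_def
    proof
      fix y assume "y \<in> \<rho> ` V"
      then obtain x where x: "x \<in> V" "y = \<rho> x" by blast
      obtain z where z: "z \<in> V" "z [^] n = x" using V_divisible x(1) unfolding power_divisible_def by blast
      have "\<rho> z [^] n = y" using \<rho>_pow[OF z(1), of n] z x by simp
      thus "\<exists>u\<in>\<rho> ` V. u [^] n = y" using z(1) by blast
    qed
    show "\<exists>s\<in>S. s \<otimes> x [^] n \<in> \<rho> ` V" if x: "x \<in> V" for x
    proof -
      obtain s where s: "s \<in> S" "\<rho> x = s \<otimes> x [^] n" using pow[OF x] by blast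
      show ?thesis by (rule bexI[OF _ s(1)]) (use s(2) x in \<open>simp flip: s(2)\<close>)
    qed
    show "D \<subseteq> {\<one>}" if D: "D \<subseteq> S" "D \<subseteq> \<rho> ` V" "power_divisible G n D" for D
    proof (rule exponent_divisible_trivial[OF D(3), of 1])
      show "D \<subseteq> carrier G" using D(1) S.subset by blast
      fix d assume d: "d \<in> D"
      then obtain e where e: "e \<in> V" "d = \<rho> e" using D(2) by blast
      obtain s where s: "s \<in> S" "\<rho> e = s \<otimes> e [^] n" using pow[OF e(1)] by blast
      have en: "e [^] n \<in> V" by (rule subgroup_nat_pow_closed[OF V.subgroup_axioms e(1)])
      \<comment> \<open>Applying \<open>\<rho>\<close> to \<open>d = s \<otimes> e [^] n\<close>
        kills both \<open>d\<close> and \<open>s\<close>, as they lie in \<open>S\<close>, and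
        leaves \<open>d [^] n = \<one>\<close>.\<close>
      have "\<one> = \<rho> (\<rho> e)" using S d D(1) e by auto
      also have "\<dots> = \<rho> s \<otimes> \<rho> (e [^] n)" unfolding s(2) using s(1) assms(2) en by (intro mult) auto
      also have "\<dots> = d [^] n" using S[OF s(1)] \<rho>_pow[OF e(1), of n] e V by simp
      finally show "d [^] (n ^ 1) = \<one>" by simp
    qed
  qed
qed

section \<open>Commutators with \<open>H\<close> and generation by quasifinite subgroups\<close>

lemma quasifinite_nontrivial: "quasifinite G D \<Longrightarrow> \<not> D \<subseteq> {\<one>}"
  unfolding quasifinite_def using finite_subset by blast

text \<open>On the abelian group \<open>V\<close> the map
  \<open>y \<mapsto> [y, h] = y^-1 y^h\<close> is a homomorphism.\<close>

lemma comm_elt_pow_left_V: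
  assumes "y \<in> V" "h \<in> carrier G"
  shows "comm_elt G (y [^] (m::nat)) h = comm_elt G y h [^] m"
proof -
  have eq: "comm_elt G x h = inv x \<otimes> (inv h \<otimes> x \<otimes> h)" if "x \<in> V" for x
    using that assms(2) by (simp add: comm_elt_def word_simps)
  have yh: "inv h \<otimes> y \<otimes> h \<in> V" by (rule V.inv_op_closed1[OF assms(2,1)])
  have "comm_elt G (y [^] m) h = inv (y [^] m) \<otimes> (inv h \<otimes> y [^] m \<otimes> h)"
    by (rule eq[OF subgroup_nat_pow_closed[OF V.subgroup_axioms assms(1)]])
  also have "\<dots> = (inv y) [^] m \<otimes> (inv h \<otimes> y \<otimes> h) [^] m"
    using conj_pow[of y "inv h" m] assms by (simp add: nat_pow_inv)
  also have "\<dots> = comm_elt G y h [^] m"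
    unfolding eq[OF assms(1)] using yh assms(1) by (simp add: V_pow_mult)
  finally show ?thesis .
qed

text \<open>A proper \<open>[D, H]\<close> would be finite, so some \<open>n ^ k\<close> kills it;
  since every \<open>d\<close> is an \<open>n ^ k\<close>-th power, all \<open>[d, h]\<close>
  vanish. Then \<open>V = [V, H]\<close> lies in the almost complement \<open>T\<close> of
  \<open>D\<close>, so \<open>D\<close> lies in \<open>T\<close> and must be trivial.\<close>

lemma comm_subgroup_quasifinite:
  assumes "D \<lhd> G" "D \<subseteq> V" "quasifinite G D" "power_divisible G n D"
  shows "comm_subgroup G D H = D"
proof (rule ccontr)
  interpret D: normal D G by fact
  define B where "B = comm_subgroup G D H"
  assume "comm_subgroup G D H \<noteq> D"
  hence "B \<subset> D" "B \<lhd> G" unfolding B_def using comm_subgroup_normal[OF assms(1,2)] by auto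
  hence fin: "finite B" and BV: "B \<subseteq> carrier VG"
    using assms(2,3) unfolding quasifinite_def by auto
  have tors: "power_torsion VG n b" if "b \<in> B" for b
    using V_torsion BV that unfolding power_torsion_def pow_VG by auto
  obtain k where k: "\<forall>b\<in>B. b [^] (n ^ k) = \<one>"
    using VG.finite_power_torsion_uniform[OF fin BV tors] unfolding pow_VG by auto
  have central: "comm_elt G d h = \<one>" if d: "d \<in> D" and h: "h \<in> H" for d h
  proof -
    obtain y where y: "y \<in> D" "y [^] (n ^ k) = d"
      using power_divisible_iterate[OF assms(4) D.subset d] by blast
    have "comm_elt G y h \<in> B"
      unfolding B_def comm_subgroup_def using y(1) h by (intro generate.incl) blast
    hence "comm_elt G y h [^] (n ^ k) = \<one>" using k by blast
    thus ?thesis using comm_elt_pow_left_V[of y h "n ^ k"] y assms(2) h by auto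
  qed
  obtain T where T: "T \<lhd> G" "T \<subseteq> V" "power_divisible G n T"
    and pow: "\<And>x. x \<in> V \<Longrightarrow> \<exists>s\<in>D. s \<otimes> x [^] n \<in> T"
    and triv: "\<And>A. \<lbrakk>A \<subseteq> D; A \<subseteq> T; power_divisible G n A\<rbrakk> \<Longrightarrow> A \<subseteq> {\<one>}"
  proof (rule almost_complement[OF assms(1,2,4)], goal_cases)
    case (1 T)
    from 1(2-) show ?case by (rule 1(1))
  qed
  have "{comm_elt G v h | v h. v \<in> V \<and> h \<in> H} \<subseteq> T"
  proof
    fix c assume "c \<in> {comm_elt G v h | v h. v \<in> V \<and> h \<in> H}"
    then obtain v h where vh: "v \<in> V" "h \<in> H" "c = comm_elt G v h" by blast
    \<comment> \<open>Writing \<open>v\<close> as an \<open>n\<close>-th power gives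
      \<open>s\<close> in \<open>D\<close> with \<open>s \<otimes> v\<close> in \<open>T\<close>; as
      \<open>s\<close> commutes with \<open>h\<close>, the commutators of \<open>v\<close> and of
      \<open>s \<otimes> v\<close> with \<open>h\<close> agree.\<close>
    obtain y where y: "y \<in> V" "y [^] n = v" using V_divisible vh(1) unfolding power_divisible_def by blast
    obtain s where s: "s \<in> D" "s \<otimes> v \<in> T" using pow[OF y(1)] y(2) by auto
    have "comm_elt G (s \<otimes> v) h = (inv v \<otimes> comm_elt G s h \<otimes> v) \<otimes> comm_elt G v h"
      using s vh by (intro comm_elt_mult_left) auto
    also have "\<dots> = c" using central[OF s(1) vh(2)] vh by simp
    finally show "c \<in> T" using comm_elt_mem_left[OF T(1) s(2), of h] vh(2) by simp
  qed
  hence "comm_subgroup G V H \<subseteq> T"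
    unfolding comm_subgroup_def by (rule generate_subgroup_incl[OF _ normal_imp_subgroup[OF T(1)]])
  hence "D \<subseteq> T" using V_commutator assms(2) by blast
  thus False using triv[OF order_refl _ assms(4)] quasifinite_nontrivial[OF assms(3)] by blast
qed

text \<open>An almost complement \<open>T\<close> of the generated subgroup \<open>S\<close> is
  trivial: otherwise it would contain a member of the family, which lies in \<open>S\<close> as
  well. Then all \<open>n\<close>-th powers, hence all elements of \<open>V\<close>, lie in
  \<open>S\<close>.\<close>

lemma generated_by_quasifinite:
  "V = generate G (\<Union>{D. D \<lhd> G \<and> D \<subseteq> V \<and> quasifinite G D \<and> power_divisible G n D})"
    (is "V = generate G (\<Union>?\<D>)")
proof
  define S where "S = generate G (\<Union>?\<D>)"
  have DV: "\<Union>?\<D> \<subseteq> V" by blast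
  have SV: "S \<subseteq> V" unfolding S_def by (rule generate_subgroup_incl[OF DV V.subgroup_axioms])
  thus "generate G (\<Union>?\<D>) \<subseteq> V" unfolding S_def .
  have Sn: "S \<lhd> G"
    unfolding S_def
  proof (rule normal_generate[OF DV])
    fix y h assume y: "y \<in> \<Union>?\<D>" and h: "h \<in> H"
    then obtain D where D: "D \<in> ?\<D>" "y \<in> D" by blast
    hence "D \<lhd> G" by blast
    hence "h \<otimes> y \<otimes> inv h \<in> D" using normal.inv_op_closed2[OF _ H.mem_carrier[OF h] D(2)] by blast
    thus "h \<otimes> y \<otimes> inv h \<in> \<Union>?\<D>" using D(1) by blast
  qed
  have Sdiv: "power_divisible G n S"
  proof -
    \<comment> \<open>The \<open>n\<close>-th powers of elements of \<open>S\<close> form a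
      subgroup, and it contains each member of the family because that member is divisible.\<close>
    have "S \<subseteq> (\<lambda>x. x [^] n) ` S"
      unfolding S_def
    proof (rule generate_subgroup_incl)
      show "\<Union>?\<D> \<subseteq> (\<lambda>x. x [^] n) ` generate G (\<Union>?\<D>)"
      proof
        fix x assume "x \<in> \<Union>?\<D>"
        then obtain D where D: "D \<in> ?\<D>" "x \<in> D" by blast
        then obtain y where y: "y \<in> D" "y [^] n = x" unfolding power_divisible_def by blast
        have "y \<in> generate G (\<Union>?\<D>)" using y(1) D(1) by (intro generate.incl) blast
        thus "x \<in> (\<lambda>x. x [^] n) ` generate G (\<Union>?\<D>)" using y(2) by blast
      qed
      show "subgroup ((\<lambda>x. x [^] n) ` generate G (\<Union>?\<D>)) G"
        using normal_imp_subgroup[OF power_image_normal(1)[OF Sn SV, of n]] unfolding S_def .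
    qed
    thus ?thesis unfolding power_divisible_def by blast
  qed
  obtain T where T: "T \<lhd> G" "T \<subseteq> V" "power_divisible G n T"
    and pow: "\<And>x. x \<in> V \<Longrightarrow> \<exists>s\<in>S. s \<otimes> x [^] n \<in> T"
    and triv: "\<And>A. \<lbrakk>A \<subseteq> S; A \<subseteq> T; power_divisible G n A\<rbrakk> \<Longrightarrow> A \<subseteq> {\<one>}"
  proof (rule almost_complement[OF Sn SV Sdiv], goal_cases)
    case (1 T)
    from 1(2-) show ?case by (rule 1(1))
  qed
  have T1: "T \<subseteq> {\<one>}"
  proof (rule ccontr)
    assume "\<not> T \<subseteq> {\<one>}"
    then obtain v where "v \<in> T" "v \<noteq> \<one>" by blast
    then obtain D where D: "D \<lhd> G" "D \<subseteq> T" "quasifinite G D" "power_divisible G n D"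
      using quasifinite_subgroup_exists[OF T] by blast
    hence "D \<in> ?\<D>" using T(2) by blast
    hence "D \<subseteq> S" unfolding S_def using generate.incl[of _ "\<Union>?\<D>" G] by blast
    thus False using triv[OF _ D(2,4)] quasifinite_nontrivial[OF D(3)] by blast
  qed
  show "V \<subseteq> generate G (\<Union>?\<D>)"
  proof
    fix v assume v: "v \<in> V"
    obtain y where y: "y \<in> V" "y [^] n = v" using V_divisible v unfolding power_divisible_def by blast
    obtain s where s: "s \<in> S" "s \<otimes> v = \<one>" using pow[OF y(1)] T1 y(2) by auto
    have sc: "s \<in> carrier G" using s(1) SV V.subset by blast
    have "v = inv s" using s(2) sc v by (metis V.mem_carrier inv_comm inv_equality)
    thus "v \<in> generate G (\<Union>?\<D>)"
      using subgroup.m_inv_closed[OF normal_imp_subgroup[OF Sn] s(1)] unfolding S_def by simp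
  qed
qed

end

section \<open>Cauchy's theorem and the assembly of the results\<close>

lemma (in group) Cauchy_subgroup:
  assumes "subgroup H G" "finite H" "Factorial_Ring.prime p" "p dvd card H"
  shows "\<exists>x\<in>H. ord x = p"
proof -
  interpret HG: group "G\<lparr>carrier := H\<rparr>" by (rule subgroup_imp_group[OF assms(1)])
  \<comment> \<open>Sylow's theorem with exponent 1 gives a subgroup of order exactly
    \<open>p\<close>, whatever the full power of \<open>p\<close> in \<open>card H\<close>.\<close>
  obtain m where m: "card H = p ^ 1 * m" using assms(4) by auto
  obtain K where K: "subgroup K (G\<lparr>carrier := H\<rparr>)" "card K = p ^ 1"
    using sylow_thm[OF assms(3) HG.is_group, of 1 m] m assms(2) by (auto simp: order_def)
  have KG: "subgroup K G" and KH: "K \<subseteq> H"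
    using incl_subgroup[OF assms(1) K(1)] subgroup.subset[OF K(1)] by auto
  have finK: "finite K" using KH assms(2) finite_subset by blast
  have "card K > 1" using K(2) prime_gt_1_nat[OF assms(3)] by simp
  then obtain x where x: "x \<in> K" "x \<noteq> \<one>" using finK by (metis card_le_Suc0_iff_eq not_less One_nat_def subgroup.one_closed[OF KG])
  have xc: "x \<in> carrier G" by (rule subgroup.mem_carrier[OF KG x(1)])
  interpret KG: group "G\<lparr>carrier := K\<rparr>" by (rule subgroup_imp_group[OF KG])
  have "x [^]\<^bsub>G\<lparr>carrier := K\<rparr>\<^esub> order (G\<lparr>carrier := K\<rparr>) = \<one>\<^bsub>G\<lparr>carrier := K\<rparr>\<^esub>"
    using x by (intro KG.pow_order_eq_1) simp
  hence "x [^] p = \<one>" using K(2) by (simp add: order_def nat_pow_consistent[symmetric])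
  hence "ord x dvd p" using pow_eq_id[OF xc] by simp
  moreover have "ord x \<noteq> 1" using x xc ord_eq_1 by blast
  ultimately have "ord x = p" using assms(3) by (metis prime_nat_iff)
  thus ?thesis using x KH by blast
qed

theorem theoremC:
  fixes G :: "('a, 'b) monoid_scheme"
  assumes "group G"
    and "hypercentral G"
    and "\<exists>H. finite H \<and> contranormal G H"
  shows "\<exists>V C. V \<lhd> G \<and> abelian_subset G V \<and> divisible_subset G V \<and>
           finite C \<and> contranormal G C \<and> V <#>\<^bsub>G\<^esub> C = carrier G \<and>
           prime_spectrum G (carrier G) = prime_spectrum G C \<and>
           finite (prime_spectrum G (carrier G)) \<and>
           (\<exists>\<D>. (\<forall>D\<in>\<D>. D \<subseteq> V \<and> D \<lhd> G \<and> quasifinite G D) \<and>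
                 V = generate G (\<Union>\<D>) \<and>
                 (\<forall>D\<in>\<D>. comm_subgroup G D C = D)) \<and>
           comm_subgroup G V C = V"
proof -
  interpret group G by fact
  obtain H where H: "finite H" "contranormal G H" using assms(3) by blast
  have Hs: "subgroup H G" and HG: "normal_closure G H = carrier G"
    using H(2) unfolding contranormal_def by auto
  interpret HG: group "G\<lparr>carrier := H\<rparr>" by (rule subgroup_imp_group[OF Hs])
  let ?n = "card H"
  have n0: "?n > 0" using H(1) subgroup.one_closed[OF Hs] card_gt_0_iff by blast
  \<comment> \<open>By contranormality the conjugates of \<open>H\<close> generate \<open>G\<close>,
    and by Lagrange \<open>?n\<close> kills each of their elements.\<close>
  have torsion: "power_torsion G ?n x" if "x \<in> carrier G" for x
  proof (rule hypercentral_generated_torsion[OF assms(2) _ _ _ that])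
    let ?Y = "\<Union>g\<in>carrier G. (\<lambda>h. g \<otimes>\<^bsub>G\<^esub> h \<otimes>\<^bsub>G\<^esub> inv\<^bsub>G\<^esub> g) ` H"
    show "generate G ?Y = carrier G" using HG unfolding normal_closure_def .
    show "?Y \<subseteq> carrier G" using subgroup.subset[OF Hs] by auto
    fix y assume "y \<in> ?Y"
    then obtain g h where gh: "g \<in> carrier G" "h \<in> H" "y = g \<otimes>\<^bsub>G\<^esub> h \<otimes>\<^bsub>G\<^esub> inv\<^bsub>G\<^esub> g" by blast
    have "h [^]\<^bsub>G\<lparr>carrier := H\<rparr>\<^esub> order (G\<lparr>carrier := H\<rparr>) = \<one>\<^bsub>G\<lparr>carrier := H\<rparr>\<^esub>"
      using gh(2) by (intro HG.pow_order_eq_1) simp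
    hence "h [^]\<^bsub>G\<^esub> (?n ^ 1) = \<one>\<^bsub>G\<^esub>" by (simp add: order_def nat_pow_consistent[symmetric])
    hence "power_torsion G ?n h" unfolding power_torsion_def by blast
    thus "power_torsion G ?n y"
      unfolding gh(3) by (rule power_torsion_conj[OF _ subgroup.mem_carrier[OF Hs gh(2)] gh(1)])
  qed
  obtain V where V: "V \<lhd> G" "V <#>\<^bsub>G\<^esub> H = carrier G"
    and nofi: "\<And>M. \<lbrakk>subgroup M G; M \<subseteq> V; finite_cover G V M\<rbrakk> \<Longrightarrow> M = V"
    using no_proper_finite_index_subgroup[OF assms(2) H(2,1)] by blast
  have Vs: "subgroup V G" by (rule normal_imp_subgroup[OF V(1)])
  have "\<exists>N>0. x [^]\<^bsub>G\<^esub> (N::nat) = \<one>\<^bsub>G\<^esub>" if "x \<in> V" for x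
    using torsion[OF subgroup.mem_carrier[OF Vs that]] n0 unfolding power_torsion_def
    by (metis zero_less_power)
  hence ab: "abelian_subset G V" and dv: "divisible_subset G V"
    using no_finite_index_abelian_divisible[OF assms(2) Vs nofi] by blast+
  interpret abelian_by_finite G V H
    using ab unfolding abelian_subset_def
    by (intro abelian_by_finite.intro abelian_by_finite_axioms.intro assms(1) V Hs H(1)) blast
  have VHV: "comm_subgroup G V H = V" by (rule comm_subgroup_eq[OF H(2) nofi])
  interpret divisible_by_finite G V H
  proof
    show "power_torsion G (card H) x" if "x \<in> V" for x using torsion that by simp
    show "power_divisible G (card H) V"
      using dv n0 unfolding divisible_subset_def power_divisible_def by blast
  qed (rule VHV)
  \<comment> \<open>The order \<open>p\<close> divides a power of \<open>?n\<close>; Cauchy's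
    theorem then finds an element of order \<open>p\<close> in \<open>H\<close>.\<close>
  have "p dvd ?n" if p: "Factorial_Ring.prime p" and x: "x \<in> carrier G" "ord x = p" for p x
  proof -
    obtain k where "x [^]\<^bsub>G\<^esub> (?n ^ k) = \<one>\<^bsub>G\<^esub>" using torsion[OF x(1)] unfolding power_torsion_def by blast
    hence "p dvd ?n ^ k" using pow_eq_id[OF x(1)] x(2) by simp
    thus ?thesis using p prime_dvd_power by blast
  qed
  hence dvd: "prime_spectrum G (carrier G) \<subseteq> {p. Factorial_Ring.prime p \<and> p dvd ?n}"
    unfolding prime_spectrum_def by blast
  hence "prime_spectrum G (carrier G) \<subseteq> prime_spectrum G H"
    using Cauchy_subgroup[OF Hs H(1)] unfolding prime_spectrum_def by blast
  hence spec: "prime_spectrum G (carrier G) = prime_spectrum G H"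
    using subgroup.subset[OF Hs] unfolding prime_spectrum_def by blast
  have fin: "finite (prime_spectrum G (carrier G))"
    using dvd n0 finite_divisors_nat[of ?n] by (auto intro: finite_subset)
  \<comment> \<open>Divisibility is added to the condition on the family because both the commutator
    and the complement arguments use it.\<close>
  let ?\<D> = "{D. D \<lhd> G \<and> D \<subseteq> V \<and> quasifinite G D \<and> power_divisible G (card H) D}"
  have "(\<forall>D\<in>?\<D>. D \<subseteq> V \<and> D \<lhd> G \<and> quasifinite G D) \<and> V = generate G (\<Union>?\<D>) \<and>
      (\<forall>D\<in>?\<D>. comm_subgroup G D H = D)"
    using generated_by_quasifinite comm_subgroup_quasifinite by blast
  hence fam: "\<exists>\<D>. (\<forall>D\<in>\<D>. D \<subseteq> V \<and> D \<lhd> G \<and> quasifinite G D) \<and> V = generate G (\<Union>\<D>) \<and>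
      (\<forall>D\<in>\<D>. comm_subgroup G D H = D)"
    by (rule exI[of _ ?\<D>])
  show ?thesis
    by (rule exI[of _ V], rule exI[of _ H]) (intro conjI V ab dv H spec fin fam VHV)
qed

end
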